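(* Assume the standing conditions ($\mathcal L$), ($E\mathcal S$), ($G|\Gamma$), ($\mathcal L_0$) of the context. Let $\mathtt x>0$ and let $\Omega(\mathtt x)$ be a random event with $P(\Omega(\mathtt x))\ge1-e^{-\mathtt x}$ on which $\sigma^{-2}\varepsilon^\top\mathbb H_G^{-1}\varepsilon\le z^2(B_{\mathcal S|G},\mathtt x)$. Let $\mathtt r_G$ be such that $\Upsilon_0$ contains $\mathcal A_G(\mathtt r_G)=\{\upsilon:\|\mathcal D_G(\upsilon-\upsilon^*_G)\|\le\mathtt r_G\}$ and $$\frac{3\delta_{3,G}(\mathtt r_G)}{\mathtt r_G^2}\le\rho\le\tfrac12,\qquad(1-\rho)\,\mathtt r_G\ge z(B_{\mathcal S|G},\mathtt x).$$ Then on $\Omega(\mathtt x)$ the estimate $\tilde\upsilon_G$ belongs to $\mathcal A_G(\mathtt r_G)$, that is, $$\|\mathcal D_G(\tilde\upsilon_G-\upsilon^*_G)\|\le\mathtt r_G ;$$ for the choice $\mathtt r_G=(1-\rho)^{-1}z(B_{\mathcal S|G},\mathtt x)$ this reads $\|\mathcal D_G(\tilde\upsilon_G-\upsilon^*_G)\|\le(1-\rho)^{-1}z(B_{\mathcal S|G},\mathtt x)$.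
   Context: Model. $\mathcal X^d,\mathcal Y^d$ are finite-dimensional Euclidean spaces, $q=\dim\mathcal Y^d$, $\Upsilon^d=\mathcal X^d\times\mathcal Y^d$, with points $\upsilon=(f,g)$; $A:\mathcal X^d\to\mathcal Y^d$ is a known smooth, possibly nonlinear operator; $\sigma,\lambda>0$. One observes a random $Y\in\mathcal Y^d$ with $EY=g^*:=A(f^* )$ for an unknown $f^*$; $\varepsilon:=\sigma^{-1}(Y-EY)$. Given $f_0\in\mathcal X^d$, $g_0\in\mathcal Y^d$ and prior precision operators $G^2$ on $\mathcal X^d$, $\Gamma^2$ on $\mathcal Y^d$ (symmetric, positive), put $$\mathcal L(\upsilon)=-\tfrac1{2\sigma^2}\|Y-g\|^2-\tfrac\lambda2\|g-A(f)\|^2,\quad \mathcal L_G(\upsilon)=\mathcal L(\upsilon)-\tfrac12\|G(f-f_0)\|^2-\tfrac12\|\Gamma(g-g_0)\|^2 .$$ $\Upsilon^\circ\subseteq\Upsilon^d$ is the parameter set and $\Upsilon_0\subseteq\Upsilon^\circ$ a local set. $\tilde\upsilon_G=(\tilde f_G,\tilde g_G)=\arg\max_{\Upsilon^\circ}\mathcal L_G$ (penalized MLE), $\upsilon^*_G=(f^*_G,g^*_G)=\arg\max_{\Upsilon^\circ}E\mathcal L_G$. Matrices. $\mathcal F_G(\upsilon)=-\nabla^2E\mathcal L_G(\upsilon)$, $\mathcal F(\upsilon)=-\nabla^2E\mathcal L(\upsilon)$, $\mathcal F_G=\mathcal F_G(\upsilon^*_G)$, $\mathcal D_G=\mathcal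 F_G^{1/2}$; $F_G(\upsilon),F(\upsilon)$ are the $ff$-blocks of $\mathcal F_G(\upsilon),\mathcal F(\upsilon)$; $\mathbb H_G^{-1}$ is the $gg$-block of $\mathcal F_G^{-1}$. Standing conditions. ($\mathcal L$): $\Upsilon^\circ$ is open and convex and $E\mathcal L_G$ is concave on it. ($E\mathcal S$): there are a positive symmetric $q\times q$ matrix $\mathcal S$ and constants $\mathtt g>0$, $\nu_0\ge1$ with $\mathrm{Var}(\varepsilon)\le\mathcal S^2$ and $\sup_{u\in\mathcal Y^d}\log E\exp\{t\langle u,\varepsilon\rangle/\|\mathcal Su\|\}\le\nu_0^2t^2/2$ for $|t|\le\mathtt g$ (with $\mathtt g=\infty$ where $z$ below is used). ($G|\Gamma$): $g_0=A(f_0)$ and for a constant $C_{G|\Gamma}$, $\|\Gamma\{A(f^* )-g_0\}\|^2\le C_{G|\Gamma}\|G(f^*-f_0)\|^2$ and $\mathrm{tr}(\sigma^2\Gamma^2+I_q)^{-1}\le C_{G|\Gamma}\,\mathrm{tr}\{F_G^{-1}(\upsilon_G^* )F(\upsilon_G^* )\}$. ($\mathcal L_0$): for the local set $\Upsilon_0$ and a set $\mathcal U^\circ\subseteq\Upsilon^d$, the directional derivatives $\partial_\alpha^mA(f)=\frac{d^m}{dt^m}A(f+t\alpha)|_{t=0}$, $m=3,4$, exist and are bounded uniformly over $(f,g)\in\Upsilon_0$, $(\alpha,\beta)\in\mathcal U^\circ$. Quantities. $z(B,\mathtt x)=\sqrt{\mathrm{tr}B}+\sqrt{2\lambda_{\max}(B)\mathtt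 x}$; $B_{\mathcal S|G}=\sigma^{-2}\mathcal S\,\mathbb H_G^{-1}\mathcal S$. With $\Phi(\upsilon)=\frac\lambda2\|g-A(f)\|^2$ and $\partial_u^3\Phi(\upsilon)=\frac{d^3}{dt^3}\Phi(\upsilon+tu)|_{t=0}$, $$\delta_{3,G}(\mathtt r)=\sup_{\upsilon:\|\mathcal D_G(\upsilon-\upsilon^*_G)\|\le\mathtt r}\ \sup_{u:\|\mathcal D_Gu\|\le\mathtt r}|\partial_u^3\Phi(\upsilon)| .$$ *)

theory Defs
  imports "HOL-Probability.Probability"
begin

section \<open>Operators on Euclidean spaces\<close>

text \<open>Matrices are rendered as linear maps of a Euclidean space into itself.\<close>

definition sym_op :: "('a::euclidean_space \<Rightarrow> 'a) \<Rightarrow> bool" where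
  "sym_op T \<longleftrightarrow> linear T \<and> (\<forall>u v. T u \<bullet> v = u \<bullet> T v)"

definition psd_op :: "('a::euclidean_space \<Rightarrow> 'a) \<Rightarrow> bool" where
  "psd_op T \<longleftrightarrow> sym_op T \<and> (\<forall>u. 0 \<le> T u \<bullet> u)"

definition pd_op :: "('a::euclidean_space \<Rightarrow> 'a) \<Rightarrow> bool" where
  "pd_op T \<longleftrightarrow> sym_op T \<and> (\<forall>u. u \<noteq> 0 \<longrightarrow> 0 < T u \<bullet> u)"

definition loewner_le :: "('a::euclidean_space \<Rightarrow> 'a) \<Rightarrow> ('a \<Rightarrow> 'a) \<Rightarrow> bool" where
  "loewner_le S T \<longleftrightarrow> (\<forall>u. S u \<bullet> u \<le> T u \<bullet> u)"

definition op_trace :: "('a::euclidean_space \<Rightarrow> 'a) \<Rightarrow> real" where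
  "op_trace T = (\<Sum>b\<in>Basis. T b \<bullet> b)"

definition lambda_max :: "('a::euclidean_space \<Rightarrow> 'a) \<Rightarrow> real" where
  "lambda_max T = Max {c. \<exists>v. v \<noteq> 0 \<and> T v = c *\<^sub>R v}"

definition op_sqrt :: "('a::euclidean_space \<Rightarrow> 'a) \<Rightarrow> 'a \<Rightarrow> 'a" where
  "op_sqrt T = (THE R. psd_op R \<and> R \<circ> R = T)"

definition ff_block ::
    "('x::euclidean_space \<times> 'y::euclidean_space \<Rightarrow> 'x \<times> 'y) \<Rightarrow> 'x \<Rightarrow> 'x" where
  "ff_block T f = fst (T (f, 0))"

definition gg_block ::
    "('x::euclidean_space \<times> 'y::euclidean_space \<Rightarrow> 'x \<times> 'y) \<Rightarrow> 'y \<Rightarrow> 'y" where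
  "gg_block T g = snd (T (0, g))"

definition z_quantile :: "('a::euclidean_space \<Rightarrow> 'a) \<Rightarrow> real \<Rightarrow> real" where
  "z_quantile B x = sqrt (op_trace B) + sqrt (2 * lambda_max B * x)"


section \<open>Derivatives\<close>

text \<open>In finite dimension, \<open>C\<^sup>k\<close> is equivalent to iterated Frechet differentiability
  in which only the values of the derivative at fixed directions are differentiated
  further; this avoids the change of type from \<open>f\<close> to its derivative.\<close>

fun C_diff :: "nat \<Rightarrow> ('a::euclidean_space \<Rightarrow> 'b::euclidean_space) \<Rightarrow> bool" where
  "C_diff 0 h \<longleftrightarrow> continuous_on UNIV h"
| "C_diff (Suc k) h \<longleftrightarrow> (\<forall>x. h differentiable (at x)) \<and>
     (\<forall>v. C_diff k (\<lambda>x. frechet_derivative h (at x) v))"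

definition smooth :: "('a::euclidean_space \<Rightarrow> 'b::euclidean_space) \<Rightarrow> bool" where
  "smooth h \<longleftrightarrow> (\<forall>k. C_diff k h)"

definition gradient :: "('a::euclidean_space \<Rightarrow> real) \<Rightarrow> 'a \<Rightarrow> 'a" where
  "gradient h x = (THE D. GDERIV h x :> D)"

definition hessian :: "('a::euclidean_space \<Rightarrow> real) \<Rightarrow> 'a \<Rightarrow> 'a \<Rightarrow> 'a" where
  "hessian h x = frechet_derivative (gradient h) (at x)"

definition info_op :: "('a::euclidean_space \<Rightarrow> real) \<Rightarrow> 'a \<Rightarrow> 'a \<Rightarrow> 'a" where
  "info_op h x u = - hessian h x u"

definition iter_deriv :: "nat \<Rightarrow> (real \<Rightarrow> 'b::euclidean_space) \<Rightarrow> real \<Rightarrow> 'b" where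
  "iter_deriv m \<phi> = ((\<lambda>\<psi> t. vector_derivative \<psi> (at t)) ^^ m) \<phi>"

definition dir_deriv ::
    "nat \<Rightarrow> ('a::euclidean_space \<Rightarrow> 'b::euclidean_space) \<Rightarrow> 'a \<Rightarrow> 'a \<Rightarrow> 'b" where
  "dir_deriv m h x u = iter_deriv m (\<lambda>t. h (x + t *\<^sub>R u)) 0"

definition dir_deriv_exists ::
    "nat \<Rightarrow> ('a::euclidean_space \<Rightarrow> 'b::euclidean_space) \<Rightarrow> 'a \<Rightarrow> 'a \<Rightarrow> bool" where
  "dir_deriv_exists m h x u \<longleftrightarrow>
     (\<forall>j<m. \<forall>\<^sub>F t in nhds 0. iter_deriv j (\<lambda>t. h (x + t *\<^sub>R u)) differentiable (at t))"


section \<open>The model\<close>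

definition fidelity :: "real \<Rightarrow> ('x::euclidean_space \<Rightarrow> 'y::euclidean_space) \<Rightarrow> 'x \<times> 'y \<Rightarrow> real" where
  "fidelity lam A \<upsilon> = lam / 2 * (norm (snd \<upsilon> - A (fst \<upsilon>)))\<^sup>2"

definition loglik ::
    "real \<Rightarrow> real \<Rightarrow> ('x::euclidean_space \<Rightarrow> 'y::euclidean_space) \<Rightarrow> 'y \<Rightarrow> 'x \<times> 'y \<Rightarrow> real" where
  "loglik \<sigma> lam A y \<upsilon> =
     - (1 / (2 * \<sigma>\<^sup>2)) * (norm (y - snd \<upsilon>))\<^sup>2 - fidelity lam A \<upsilon>"

definition pen_loglik ::
    "real \<Rightarrow> real \<Rightarrow> ('x::euclidean_space \<Rightarrow> 'y::euclidean_space) \<Rightarrow> ('x \<Rightarrow> 'x) \<Rightarrow> ('y \<Rightarrow> 'y) \<Rightarrow>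
     'x \<Rightarrow> 'y \<Rightarrow> 'y \<Rightarrow> 'x \<times> 'y \<Rightarrow> real" where
  "pen_loglik \<sigma> lam A G \<Gamma> f0 g0 y \<upsilon> =
     loglik \<sigma> lam A y \<upsilon> - 1 / 2 * (norm (G (fst \<upsilon> - f0)))\<^sup>2 - 1 / 2 * (norm (\<Gamma> (snd \<upsilon> - g0)))\<^sup>2"

definition covariance_op ::
    "'w measure \<Rightarrow> ('w \<Rightarrow> 'y::euclidean_space) \<Rightarrow> 'y \<Rightarrow> 'y" where
  "covariance_op M X u =
     (let \<mu> = (\<integral>\<omega>. X \<omega> \<partial>M) in (\<integral>\<omega>. (u \<bullet> (X \<omega> - \<mu>)) *\<^sub>R (X \<omega> - \<mu>) \<partial>M))"

definition loc_set ::
    "('x::euclidean_space \<times> 'y::euclidean_space \<Rightarrow> 'x \<times> 'y) \<Rightarrow> 'x \<times> 'y \<Rightarrow> real \<Rightarrow> ('x \<times> 'y) set" where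
  "loc_set D \<upsilon>s r = {\<upsilon>. norm (D (\<upsilon> - \<upsilon>s)) \<le> r}"

text \<open>The suprema are taken in the reals; they are finite when \<open>A\<close> is smooth and \<open>D\<close> is
  linear and invertible, since then both index sets are compact.\<close>

definition delta3 ::
    "real \<Rightarrow> ('x::euclidean_space \<Rightarrow> 'y::euclidean_space) \<Rightarrow>
     ('x \<times> 'y \<Rightarrow> 'x \<times> 'y) \<Rightarrow> 'x \<times> 'y \<Rightarrow> real \<Rightarrow> real" where
  "delta3 lam A D \<upsilon>s r =
     (SUP \<upsilon> \<in> loc_set D \<upsilon>s r. SUP u \<in> {u. norm (D u) \<le> r}.
        \<bar>dir_deriv 3 (fidelity lam A) \<upsilon> u\<bar>)"


section \<open>Conditions\<close>

definition cond_L :: "('x::euclidean_space \<times> 'y::euclidean_space) set \<Rightarrow> ('x \<times> 'y \<Rightarrow> real) \<Rightarrow> bool" where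
  "cond_L U ELG \<longleftrightarrow> open U \<and> convex U \<and> concave_on U ELG"

text \<open>The integrability clauses express that the variance and the exponential moments
  exist: a Bochner integral that does not exist has value 0, and \<open>ln 0 = 0\<close>.\<close>

definition cond_ES ::
    "'w measure \<Rightarrow> ('w \<Rightarrow> 'y::euclidean_space) \<Rightarrow> ('y \<Rightarrow> 'y) \<Rightarrow> ereal \<Rightarrow> real \<Rightarrow> bool" where
  "cond_ES M \<epsilon> S gmax \<nu>\<^sub>0 \<longleftrightarrow>
     pd_op S \<and> gmax > 0 \<and> \<nu>\<^sub>0 \<ge> 1 \<and>
     integrable M (\<lambda>\<omega>. (norm (\<epsilon> \<omega>))\<^sup>2) \<and> loewner_le (covariance_op M \<epsilon>) (S \<circ> S) \<and>
     (\<forall>t::real. ereal \<bar>t\<bar> \<le> gmax \<longrightarrow> (\<forall>u. u \<noteq> 0 \<longrightarrow>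
        integrable M (\<lambda>\<omega>. exp (t * (u \<bullet> \<epsilon> \<omega>) / norm (S u))) \<and>
        ln (\<integral>\<omega>. exp (t * (u \<bullet> \<epsilon> \<omega>) / norm (S u)) \<partial>M) \<le> \<nu>\<^sub>0\<^sup>2 * t\<^sup>2 / 2))"

text \<open>\<open>FGff\<close> and \<open>Fff\<close> stand for the ff-blocks of the negative Hessians of the expected
  penalized and unpenalized log-likelihood at the population maximizer.\<close>

definition cond_GGamma ::
    "real \<Rightarrow> ('x::euclidean_space \<Rightarrow> 'y::euclidean_space) \<Rightarrow> ('x \<Rightarrow> 'x) \<Rightarrow> ('y \<Rightarrow> 'y) \<Rightarrow>
     'x \<Rightarrow> 'y \<Rightarrow> 'x \<Rightarrow> ('x \<Rightarrow> 'x) \<Rightarrow> ('x \<Rightarrow> 'x) \<Rightarrow> real \<Rightarrow> bool" where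
  "cond_GGamma \<sigma> A G \<Gamma> f0 g0 fs FGff Fff C \<longleftrightarrow>
     g0 = A f0 \<and>
     (norm (\<Gamma> (A fs - g0)))\<^sup>2 \<le> C * (norm (G (fs - f0)))\<^sup>2 \<and>
     op_trace (inv (\<lambda>g. \<sigma>\<^sup>2 *\<^sub>R \<Gamma> (\<Gamma> g) + g)) \<le> C * op_trace (inv FGff \<circ> Fff)"

definition cond_L0 ::
    "('x::euclidean_space \<Rightarrow> 'y::euclidean_space) \<Rightarrow> ('x \<times> 'y) set \<Rightarrow> ('x \<times> 'y) set \<Rightarrow> bool" where
  "cond_L0 A \<Upsilon>\<^sub>0 \<U> \<longleftrightarrow>
     (\<forall>m\<in>{3, 4::nat}. \<exists>K. \<forall>(f, g)\<in>\<Upsilon>\<^sub>0. \<forall>(\<alpha>, \<beta>)\<in>\<U>.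
        dir_deriv_exists m A f \<alpha> \<and> norm (dir_deriv m A f \<alpha>) \<le> K)"

end

theory Submission
  imports Defs
begin

text \<open>The noise enters \<open>L\<^sub>G\<close> only through the linear term \<open>\<sigma>\<^sup>-\<^sup>1 \<epsilon> \<bullet> g\<close> and a constant
  (\<open>pen_loglik_shift\<close>, \<open>expected_pen_loglik\<close>).  The estimate therefore maximizes a linear
  perturbation of the smooth concave function \<open>E L\<^sub>G\<close>, whose maximizer is \<open>\<upsilon>s\<close>, and the
  question is how far such a perturbation can move the maximizer.

  Suppose that it moves it out of the local set, and let \<open>u\<close> be the vector from \<open>\<upsilon>s\<close> to the
  point where the segment to the estimate crosses the boundary, so that \<open>\<parallel>D\<^sub>G u\<parallel> = r\<close>.  On this
  segment the second derivative of \<open>E L\<^sub>G\<close> in direction \<open>u\<close> is \<open>-r\<^sup>2\<close> at \<open>\<upsilon>s\<close>.  All of \<open>E L\<^sub>G\<close>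
  except the fidelity term is quadratic, so this second derivative changes by at most
  \<open>\<delta>\<^sub>3 \<le> \<rho> r\<^sup>2 / 3\<close> up to the boundary, and the slope of \<open>E L\<^sub>G\<close> there is at most
  \<open>-r\<^sup>2 + \<delta>\<^sub>3\<close>.  On the event the Cauchy-Schwarz inequality in the metric of \<open>D\<^sub>G\<close> bounds the
  slope of the noise term by \<open>z r \<le> (1 - \<rho>) r\<^sup>2\<close> (\<open>inner_snd_le_gg_block\<close>).  The total slope is
  thus at most \<open>\<delta>\<^sub>3 - \<rho> r\<^sup>2 \<le> 0\<close>, and the second derivative is still negative.  A concave
  function with these properties at the boundary cannot have a maximizer further out on the ray
  (\<open>concave_max_beyond_descent_False\<close>, \<open>perturbed_max_in_local_set\<close>).

  The objects in this argument must first be shown to be what their names say.  The operator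
  \<open>D\<^sub>G\<close> is given by definite description, so existence and uniqueness of positive semidefinite
  roots are needed (\<open>op_sqrt_psd\<close>), which rest on the spectral theorem and on the symmetry of the
  Hessian (\<open>sym_op_info_op\<close>).  The spectral theorem also shows that the largest eigenvalue
  in the quantile \<open>z\<close> exists and is nonnegative.  The supremum \<open>\<delta>\<^sub>3\<close> is an upper bound because third
  directional derivatives are continuous jointly in point and direction (\<open>delta3_upper\<close>).\<close>

section \<open>Symmetric operators: spectral decomposition and square roots\<close>

lemma psd_op_sym: "psd_op T \<Longrightarrow> sym_op T"
  by (simp add: psd_op_def)

lemma nonneg_quadratic_imp_linear_zero:
  fixes a b :: real
  assumes "\<And>t. 0 \<le> 2 * t * a + t\<^sup>2 * b"
  shows "a = 0"
proof (rule ccontr)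
  assume "a \<noteq> 0"
  define k where "k = 1 + \<bar>b\<bar>"
  have k: "k > 0" "b < k" by (auto simp: k_def)
  \<comment> \<open>Near \<open>t = 0\<close> the linear term dominates; \<open>k > b\<close> makes \<open>t = -a / k\<close> small enough.\<close>
  have "0 \<le> 2 * (- a / k) * a + (- a / k)\<^sup>2 * b" using assms .
  also have "\<dots> = (a\<^sup>2 / k) * (b / k - 2)"
    using k by (simp add: field_simps power2_eq_square)
  also have "\<dots> < 0"
    using k \<open>a \<noteq> 0\<close> by (intro mult_pos_neg) (auto simp: field_simps)
  finally show False by simp
qed

text \<open>The Rayleigh quotient attains its maximum \<open>c\<close> on the unit sphere of \<open>V\<close>.  At a
  maximizer \<open>v\<close> the form \<open>u \<mapsto> c \<parallel>u\<parallel>\<^sup>2 - T u \<bullet> u\<close>, which is nonnegative on \<open>V\<close>, vanishes;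
  its first variation therefore vanishes too, which says that \<open>c v - T v\<close> is orthogonal
  to \<open>V\<close>.  As this vector lies in \<open>V\<close>, it is zero.\<close>

lemma sym_op_eigenvector_in_invariant_subspace:
  fixes T :: "'a::euclidean_space \<Rightarrow> 'a"
  assumes T: "sym_op T" and V: "subspace V" "T ` V \<subseteq> V" and ne: "\<exists>v\<in>V. v \<noteq> 0"
  obtains v c where "v \<in> V" "norm v = 1" "T v = c *\<^sub>R v"
proof -
  have lin: "linear T" and symT: "\<And>u v. T u \<bullet> v = u \<bullet> T v"
    using T by (auto simp: sym_op_def)
  let ?K = "sphere 0 1 \<inter> V"
  have "compact ?K"
    using closed_subspace[OF V(1)] by (intro compact_Int_closed) auto
  moreover have "?K \<noteq> {}"
  proof -
    obtain v where "v \<in> V" "v \<noteq> 0" using ne by auto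
    then have "(1 / norm v) *\<^sub>R v \<in> ?K" using V(1) by (auto simp: subspace_def)
    then show ?thesis by blast
  qed
  moreover have "continuous_on ?K (\<lambda>v. T v \<bullet> v)"
    using lin by (intro continuous_intros linear_continuous_on) (simp add: linear_conv_bounded_linear)
  ultimately obtain v where v: "v \<in> ?K" and max: "\<And>u. u \<in> ?K \<Longrightarrow> T u \<bullet> u \<le> T v \<bullet> v"
    using continuous_attains_sup[of ?K "\<lambda>v. T v \<bullet> v"] by blast
  define c where "c = T v \<bullet> v"
  have form_nonneg: "0 \<le> c * (u \<bullet> u) - T u \<bullet> u" if "u \<in> V" for u
  proof (cases "u = 0")
    case False
    then have "(1 / norm u) *\<^sub>R u \<in> ?K" using V(1) that by (auto simp: subspace_def)
    from max[OF this] have "(T u \<bullet> u) / (norm u)\<^sup>2 \<le> c"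
      using lin by (simp add: c_def linear_scale power2_eq_square)
    then show ?thesis using False by (simp add: field_simps power2_norm_eq_inner)
  qed (use lin linear_0 in auto)
  have "v \<in> V" "v \<bullet> v = 1" using v by (auto simp: dot_square_norm)
  define w where "w = c *\<^sub>R v - T v"
  have "w \<in> V" using V \<open>v \<in> V\<close> by (auto simp: w_def subspace_def intro!: subspace_diff)
  have "w \<bullet> w = 0"
  proof (rule nonneg_quadratic_imp_linear_zero[of _ "c * (w \<bullet> w) - T w \<bullet> w"])
    fix t :: real
    have "v + t *\<^sub>R w \<in> V" using V(1) \<open>v \<in> V\<close> \<open>w \<in> V\<close> by (auto simp: subspace_def)
    from form_nonneg[OF this]
    have "0 \<le> c * (v \<bullet> v + 2 * t * (v \<bullet> w) + t\<^sup>2 * (w \<bullet> w))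
        - (T v \<bullet> v + 2 * t * (T v \<bullet> w) + t\<^sup>2 * (T w \<bullet> w))"
      using lin symT[of w v]
      by (simp add: linear_add linear_scale inner_simps power2_eq_square algebra_simps
          inner_commute)
    also have "\<dots> = 2 * t * (w \<bullet> w) + t\<^sup>2 * (c * (w \<bullet> w) - T w \<bullet> w)"
    proof -
      have ww: "w \<bullet> w = c * (v \<bullet> w) - T v \<bullet> w"
        by (subst w_def) (simp add: inner_diff_left)
      show ?thesis unfolding ww using \<open>v \<bullet> v = 1\<close> c_def by (simp add: algebra_simps)
    qed
    finally show "0 \<le> 2 * t * (w \<bullet> w) + t\<^sup>2 * (c * (w \<bullet> w) - T w \<bullet> w)" .
  qed
  then have "T v = c *\<^sub>R v" by (simp add: w_def)
  with v show ?thesis by (intro that[of v c]) auto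
qed

definition orthonormal_eigenbasis ::
    "('a::euclidean_space \<Rightarrow> 'a) \<Rightarrow> 'a set \<Rightarrow> ('a \<Rightarrow> real) \<Rightarrow> bool" where
  "orthonormal_eigenbasis T E c \<longleftrightarrow> finite E \<and> (\<forall>e\<in>E. T e = c e *\<^sub>R e) \<and>
    (\<forall>e\<in>E. \<forall>e'\<in>E. e \<bullet> e' = (if e = e' then 1 else 0)) \<and>
    (\<forall>x. (\<Sum>e\<in>E. (x \<bullet> e) *\<^sub>R e) = x)"

text \<open>An orthonormal set of eigenvectors of maximal size is a basis: otherwise its
  orthogonal complement, which is invariant because \<open>T\<close> is symmetric, would contain a
  further eigenvector.\<close>

lemma spectral_theorem:
  fixes T :: "'a::euclidean_space \<Rightarrow> 'a"
  assumes T: "sym_op T"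
  shows "\<exists>E c. orthonormal_eigenbasis T E c"
proof -
  have lin: "linear T" and symT: "\<And>u v. T u \<bullet> v = u \<bullet> T v"
    using T by (auto simp: sym_op_def)
  define good where "good E \<longleftrightarrow> finite E \<and> (\<forall>e\<in>E. \<exists>c. T e = c *\<^sub>R e) \<and>
    (\<forall>e\<in>E. \<forall>e'\<in>E. e \<bullet> e' = (if e = e' then 1 else 0))" for E :: "'a set"
  have card_good: "card E \<le> DIM('a)" if "good E" for E
  proof -
    have "pairwise orthogonal E" "0 \<notin> E"
      using that by (force simp: good_def pairwise_def orthogonal_def)+
    then show ?thesis
      using pairwise_orthogonal_independent independent_bound by blast
  qed
  have "good {}" by (simp add: good_def)
  then have "\<exists>E. good E \<and> (\<forall>E'. good E' \<longrightarrow> card E' \<le> card E)"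
    using card_good by (intro ex_has_greatest_nat[of good _ card "Suc DIM('a)"]) (auto simp: less_Suc_eq_le)
  then obtain E where E: "good E" and maxE: "\<And>E'. good E' \<Longrightarrow> card E' \<le> card E"
    by blast
  have fin: "finite E"
    and orth: "\<And>e e'. e \<in> E \<Longrightarrow> e' \<in> E \<Longrightarrow> e \<bullet> e' = (if e = e' then 1 else 0)"
    using E by (auto simp: good_def)
  obtain c where c: "\<And>e. e \<in> E \<Longrightarrow> T e = c e *\<^sub>R e"
    using E unfolding good_def by metis
  define V where "V = {v. \<forall>e\<in>E. v \<bullet> e = 0}"
  have "subspace V" by (auto simp: V_def subspace_def inner_simps)
  have "T ` V \<subseteq> V" using symT c by (auto simp: V_def)
  have V0: "v = 0" if "v \<in> V" for v
  proof (rule ccontr)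
    assume "v \<noteq> 0"
    then obtain w d where w: "w \<in> V" "norm w = 1" "T w = d *\<^sub>R w"
      using sym_op_eigenvector_in_invariant_subspace[OF T \<open>subspace V\<close> \<open>T ` V \<subseteq> V\<close>] \<open>v \<in> V\<close>
      by blast
    have ww: "w \<bullet> w = 1" using w(2) by (simp add: dot_square_norm)
    have "w \<notin> E" using w(1) ww by (auto simp: V_def)
    have "good (insert w E)"
      using E w ww unfolding good_def V_def by (auto simp: inner_commute)
    from maxE[OF this] show False using \<open>w \<notin> E\<close> fin by simp
  qed
  have expand: "(\<Sum>e\<in>E. (x \<bullet> e) *\<^sub>R e) = x" for x
  proof -
    have "x - (\<Sum>e\<in>E. (x \<bullet> e) *\<^sub>R e) \<in> V"
    proof -
      have "(x - (\<Sum>e\<in>E. (x \<bullet> e) *\<^sub>R e)) \<bullet> e' = 0" if "e' \<in> E" for e'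
      proof -
        have "(\<Sum>e\<in>E. (x \<bullet> e) *\<^sub>R e) \<bullet> e' = (\<Sum>e\<in>E. if e = e' then x \<bullet> e else 0)"
          unfolding inner_sum_left using orth that by (intro sum.cong) auto
        also have "\<dots> = x \<bullet> e'" using fin that by simp
        finally show ?thesis by (simp add: inner_diff_left)
      qed
      then show ?thesis by (simp add: V_def)
    qed
    from V0[OF this] show ?thesis by simp
  qed
  have "orthonormal_eigenbasis T E c"
    unfolding orthonormal_eigenbasis_def using fin c orth expand by simp
  then show ?thesis by blast
qed

text \<open>On a \<open>c\<close>-eigenvector of \<open>R \<circ> R\<close> a positive semidefinite \<open>R\<close> must act as \<open>\<surd>c\<close>:
  the vector \<open>R e - \<surd>c e\<close> would otherwise be an eigenvector of \<open>R\<close> for \<open>-\<surd>c\<close>.\<close>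

lemma psd_op_root_on_eigenvector:
  assumes R: "psd_op R" and c: "c \<ge> 0" "R (R e) = c *\<^sub>R e"
  shows "R e = sqrt c *\<^sub>R e"
proof -
  have lin: "linear R" and sym: "\<And>u v. R u \<bullet> v = u \<bullet> R v" and pos: "\<And>u. 0 \<le> R u \<bullet> u"
    using R by (auto simp: psd_op_def sym_op_def)
  show ?thesis
  proof (cases "c = 0")
    case True
    have "R e \<bullet> R e = 0" using sym[of "R e" e] c True by simp
    then show ?thesis using True by simp
  next
    case False
    define w where "w = R e - sqrt c *\<^sub>R e"
    have "R w = - sqrt c *\<^sub>R w"
      using lin c by (simp add: w_def linear_diff linear_scale algebra_simps)
    then have "R w \<bullet> w = - sqrt c * (w \<bullet> w)" by simp
    with pos[of w] have "sqrt c * (w \<bullet> w) \<le> 0" by linarith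
    then have "w \<bullet> w \<le> 0" using False c by (simp add: mult_le_0_iff)
    then have "w = 0" by (meson inner_eq_zero_iff inner_ge_zero order_antisym)
    then show ?thesis by (simp add: w_def)
  qed
qed

lemma op_sqrt_psd:
  fixes T :: "'a::euclidean_space \<Rightarrow> 'a"
  assumes T: "psd_op T"
  shows "psd_op (op_sqrt T)" "op_sqrt T \<circ> op_sqrt T = T"
proof -
  obtain E c where "orthonormal_eigenbasis T E c"
    using spectral_theorem[OF psd_op_sym[OF T]] by blast
  then have fin: "finite E" and eig: "\<And>e. e \<in> E \<Longrightarrow> T e = c e *\<^sub>R e"
    and orth: "\<And>e e'. e \<in> E \<Longrightarrow> e' \<in> E \<Longrightarrow> e \<bullet> e' = (if e = e' then 1 else 0)"
    and expand: "\<And>x. (\<Sum>e\<in>E. (x \<bullet> e) *\<^sub>R e) = x"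
    by (simp_all add: orthonormal_eigenbasis_def)
  have c: "c e \<ge> 0" if "e \<in> E" for e
    using T eig[OF that] orth[OF that that] by (auto simp: psd_op_def dest: spec[of _ e])
  have ext: "R = R'" if "linear R" "linear R'" "\<And>e. e \<in> E \<Longrightarrow> R e = R' e" for R R' :: "'a \<Rightarrow> 'a"
  proof
    fix x
    have "R (\<Sum>e\<in>E. (x \<bullet> e) *\<^sub>R e) = R' (\<Sum>e\<in>E. (x \<bullet> e) *\<^sub>R e)"
      using that by (simp add: linear_sum linear_scale)
    then show "R x = R' x" by (simp only: expand)
  qed
  define R where "R x = (\<Sum>e\<in>E. (sqrt (c e) * (x \<bullet> e)) *\<^sub>R e)" for x
  have linR: "linear R"
    by (rule linearI) (simp_all add: R_def inner_simps sum.distrib scaleR_sum_right algebra_simps)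
  have Re: "R e = sqrt (c e) *\<^sub>R e" if "e \<in> E" for e
  proof -
    have "R e = (\<Sum>e'\<in>E. if e' = e then sqrt (c e) *\<^sub>R e else 0)"
      unfolding R_def using orth that by (intro sum.cong) auto
    then show ?thesis using fin that by simp
  qed
  have R: "psd_op R"
    unfolding psd_op_def sym_op_def
  proof (intro conjI allI)
    show "linear R" by (fact linR)
    show "R u \<bullet> v = u \<bullet> R v" for u v
      by (simp add: R_def inner_sum_left inner_sum_right inner_commute[of _ v] mult_ac)
    have "R u \<bullet> u = (\<Sum>e\<in>E. sqrt (c e) * (u \<bullet> e)\<^sup>2)" for u
      by (simp add: R_def inner_sum_right inner_commute[of _ u] power2_eq_square mult_ac)
    then show "0 \<le> R u \<bullet> u" for u using c by (simp add: sum_nonneg)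
  qed
  have linT: "linear T" using T by (simp add: psd_op_def sym_op_def)
  have RR: "R \<circ> R = T"
    using linR linT Re eig c
    by (intro ext) (auto simp: linear_compose linear_scale)
  have unique: "R' = R" if "psd_op R'" "R' \<circ> R' = T" for R'
  proof (rule ext)
    show "linear R'" using that by (simp add: psd_op_def sym_op_def)
    show "linear R" by (fact linR)
    show "R' e = R e" if "e \<in> E" for e
      using psd_op_root_on_eigenvector[OF \<open>psd_op R'\<close> c[OF that]] eig[OF that] Re[OF that]
        \<open>R' \<circ> R' = T\<close> by (metis comp_apply)
  qed
  have "op_sqrt T = R"
    unfolding op_sqrt_def using R RR unique by (intro the_equality conjI) blast+
  then show "psd_op (op_sqrt T)" "op_sqrt T \<circ> op_sqrt T = T" using R RR by simp_all
qed

text \<open>The maximum in \<^const>\<open>lambda_max\<close> is taken over a finite nonempty set, because all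
  eigenvalues occur among those of an orthonormal eigenbasis.  It is therefore itself an
  eigenvalue, and nonnegative.\<close>

lemma lambda_max_nonneg:
  fixes T :: "'a::euclidean_space \<Rightarrow> 'a"
  assumes T: "psd_op T"
  shows "0 \<le> lambda_max T"
proof -
  obtain E c where "orthonormal_eigenbasis T E c"
    using spectral_theorem[OF psd_op_sym[OF T]] by blast
  then have fin: "finite E" and eig: "\<And>e. e \<in> E \<Longrightarrow> T e = c e *\<^sub>R e"
    and orth: "\<And>e e'. e \<in> E \<Longrightarrow> e' \<in> E \<Longrightarrow> e \<bullet> e' = (if e = e' then 1 else 0)"
    and expand: "\<And>x. (\<Sum>e\<in>E. (x \<bullet> e) *\<^sub>R e) = x"
    by (simp_all add: orthonormal_eigenbasis_def)
  have symT: "\<And>u v. T u \<bullet> v = u \<bullet> T v" using T by (auto simp: psd_op_def sym_op_def)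
  let ?S = "{c. \<exists>v. v \<noteq> 0 \<and> T v = c *\<^sub>R v}"
  have "?S \<subseteq> c ` E"
  proof clarify
    fix d v assume "v \<noteq> 0" "T v = d *\<^sub>R v"
    have "\<exists>e\<in>E. v \<bullet> e \<noteq> 0"
    proof (rule ccontr)
      assume "\<not> ?thesis"
      then have "(\<Sum>e\<in>E. (v \<bullet> e) *\<^sub>R e) = 0" by simp
      with expand[of v] \<open>v \<noteq> 0\<close> show False by simp
    qed
    then obtain e where e: "e \<in> E" "v \<bullet> e \<noteq> 0" by blast
    have "d * (v \<bullet> e) = c e * (v \<bullet> e)"
      using symT[of v e] eig[OF e(1)] \<open>T v = d *\<^sub>R v\<close> by simp
    with e show "d \<in> c ` E" by simp
  qed
  then have "finite ?S" using fin finite_surj by blast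
  moreover have "?S \<noteq> {}"
  proof -
    have "\<exists>v\<in>(UNIV :: 'a set). v \<noteq> 0" using nonzero_Basis SOME_Basis by blast
    then obtain v d where "norm v = 1" "T v = d *\<^sub>R v"
      using sym_op_eigenvector_in_invariant_subspace[OF psd_op_sym[OF T] subspace_UNIV] by auto
    moreover have "v \<noteq> 0" using \<open>norm v = 1\<close> by auto
    ultimately show ?thesis by blast
  qed
  ultimately have "Max ?S \<in> ?S" by (rule Max_in)
  then obtain v where v: "v \<noteq> 0" "T v = lambda_max T *\<^sub>R v"
    unfolding lambda_max_def by blast
  have "0 \<le> T v \<bullet> v" using T by (simp add: psd_op_def)
  then have "0 \<le> lambda_max T * (v \<bullet> v)" using v(2) by simp
  moreover have "0 < v \<bullet> v" using v(1) by simp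
  ultimately show ?thesis by (simp add: zero_le_mult_iff)
qed

lemma z_quantile_nonneg:
  assumes "psd_op B" "x \<ge> 0"
  shows "0 \<le> z_quantile B x"
proof -
  have "0 \<le> op_trace B"
    using assms(1) by (auto simp: op_trace_def psd_op_def intro!: sum_nonneg)
  then show ?thesis
    using lambda_max_nonneg[OF assms(1)] assms(2) by (simp add: z_quantile_def)
qed

lemma psd_op_bij_inv:
  fixes T :: "'a::euclidean_space \<Rightarrow> 'a"
  assumes T: "psd_op T" and bij: "bij T"
  shows "psd_op (inv T)"
proof -
  have lin: "linear T" and sym: "\<And>u v. T u \<bullet> v = u \<bullet> T v" and pos: "\<And>u. 0 \<le> T u \<bullet> u"
    using T by (auto simp: psd_op_def sym_op_def)
  have Ti: "T (inv T u) = u" for u using bij by (simp add: bij_is_surj surj_f_inv_f)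
  show ?thesis
    unfolding psd_op_def sym_op_def
  proof (intro conjI allI)
    have eqI: "inv T u = v" if "u = T v" for u v using that bij by (simp add: bij_is_inj)
    show "linear (inv T)"
      by (rule linearI; rule eqI) (simp_all add: linear_add[OF lin] linear_scale[OF lin] Ti)
    show "inv T u \<bullet> v = u \<bullet> inv T v" for u v using sym[of "inv T u" "inv T v"] Ti by simp
    show "0 \<le> inv T u \<bullet> u" for u using pos[of "inv T u"] Ti by (simp add: inner_commute)
  qed
qed

lemma psd_op_gg_block:
  assumes "psd_op T"
  shows "psd_op (gg_block T)"
proof -
  have lin: "linear T" and sym: "\<And>u v. T u \<bullet> v = u \<bullet> T v" and pos: "\<And>u. 0 \<le> T u \<bullet> u"
    using assms by (auto simp: psd_op_def sym_op_def)
  have block: "gg_block T g \<bullet> h = T (0, g) \<bullet> (0, h)" for g h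
    by (simp add: gg_block_def inner_prod_def)
  show ?thesis
    unfolding psd_op_def sym_op_def
  proof (intro conjI allI)
    show "linear (gg_block T)"
      unfolding gg_block_def
    proof (rule linearI)
      show "snd (T (0, g + h)) = snd (T (0, g)) + snd (T (0, h))" for g h
        using linear_add[OF lin, of "(0, g)" "(0, h)"] by simp
      show "snd (T (0, t *\<^sub>R g)) = t *\<^sub>R snd (T (0, g))" for t g
        using linear_scale[OF lin, of t "(0, g)"] by simp
    qed
    show "gg_block T u \<bullet> v = u \<bullet> gg_block T v" for u v
      using block[of u v] block[of v u] sym[of "(0, u)" "(0, v)"] by (simp add: inner_commute)
    show "0 \<le> gg_block T u \<bullet> u" for u using block pos by simp
  qed
qed

lemma psd_op_congruence:
  assumes S: "sym_op S" and H: "psd_op H" and "a \<ge> 0"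
  shows "psd_op (\<lambda>g. a *\<^sub>R S (H (S g)))"
proof -
  have symS: "S u \<bullet> v = u \<bullet> S v" for u v using S by (simp add: sym_op_def)
  have symH: "H u \<bullet> v = u \<bullet> H v" and pos: "0 \<le> H u \<bullet> u" for u v
    using H by (auto simp: psd_op_def sym_op_def)
  show ?thesis
    unfolding psd_op_def sym_op_def
  proof (intro conjI allI)
    show "linear (\<lambda>g. a *\<^sub>R S (H (S g)))"
      using S H by (simp add: psd_op_def sym_op_def linear_iff algebra_simps)
    show "a *\<^sub>R S (H (S u)) \<bullet> v = u \<bullet> a *\<^sub>R S (H (S v))" for u v by (simp add: symS symH)
    show "0 \<le> a *\<^sub>R S (H (S u)) \<bullet> u" for u using \<open>a \<ge> 0\<close> pos by (simp add: symS[of _ u])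
  qed
qed

section \<open>Calculus of smooth functions\<close>

lemma C_diff_Suc_has_derivative:
  assumes "C_diff (Suc k) h"
  shows "(h has_derivative frechet_derivative h (at x)) (at x)"
  using assms by (simp add: frechet_derivative_works)

lemma C_diff_SucI:
  assumes "\<And>x. (h has_derivative h' x) (at x)" and "\<And>v. C_diff k (\<lambda>x. h' x v)"
  shows "C_diff (Suc k) h"
proof -
  have "frechet_derivative h (at x) = h' x" for x
    using assms(1) frechet_derivative_at by metis
  then show ?thesis using assms by (auto simp: differentiable_def)
qed

lemma C_diff_Suc_D: "C_diff (Suc k) h \<Longrightarrow> C_diff k h"
proof (induction k arbitrary: h)
  case 0
  then show ?case
    by (simp add: continuous_at_imp_continuous_on differentiable_imp_continuous_within)
next
  case (Suc k)
  have "C_diff k (\<lambda>x. frechet_derivative h (at x) v)" for v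
    using Suc.IH Suc.prems by (metis C_diff.simps(2))
  then show ?case using Suc.prems by (metis C_diff.simps(2))
qed

lemma C_diff_const: "C_diff k (\<lambda>x. c)"
  by (induction k arbitrary: c) (auto intro!: C_diff_SucI[where h' = "\<lambda>_ _. 0"] simp del: C_diff.simps(2))

lemma C_diff_linear:
  assumes "linear f"
  shows "C_diff k f"
proof -
  have bl: "bounded_linear f" using assms by (simp add: linear_conv_bounded_linear)
  show ?thesis
  proof (cases k)
    case 0
    then show ?thesis using bl by (simp add: linear_continuous_on)
  next
    case (Suc n)
    show ?thesis unfolding Suc
      by (rule C_diff_SucI[where h' = "\<lambda>_. f"])
        (use bl in \<open>auto intro: bounded_linear_imp_has_derivative C_diff_const\<close>)
  qed
qed

lemma C_diff_add:
  "C_diff k h \<Longrightarrow> C_diff k g \<Longrightarrow> C_diff k (\<lambda>x. h x + g x)"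
proof (induction k arbitrary: h g)
  case 0
  then show ?case by (auto intro: continuous_on_add)
next
  case (Suc k)
  show ?case
    by (rule C_diff_SucI[OF has_derivative_add[OF Suc.prems[THEN C_diff_Suc_has_derivative]]])
      (use Suc in auto)
qed

lemma C_diff_linear_comp:
  assumes "linear f"
  shows "C_diff k h \<Longrightarrow> C_diff k (\<lambda>x. f (h x))"
proof (induction k arbitrary: h)
  case 0
  then show ?case
    using assms by (auto intro: linear_continuous_on_compose)
next
  case (Suc k)
  have bl: "bounded_linear f" using assms by (simp add: linear_conv_bounded_linear)
  show ?case
    by (rule C_diff_SucI[OF bounded_linear.has_derivative[OF bl
            Suc.prems[THEN C_diff_Suc_has_derivative]]])
      (use Suc in auto)
qed

lemma C_diff_comp_linear:
  assumes "linear f"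
  shows "C_diff k h \<Longrightarrow> C_diff k (\<lambda>x. h (f x))"
proof (induction k arbitrary: h)
  case 0
  then show ?case
    using assms linear_continuous_on[of f UNIV]
    by (auto simp: linear_conv_bounded_linear intro: continuous_on_compose2)
next
  case (Suc k)
  have "(f has_derivative f) (at x)" for x
    using assms by (simp add: linear_conv_bounded_linear bounded_linear_imp_has_derivative)
  then show ?case
    by (rule C_diff_SucI[OF has_derivative_compose[OF _
            Suc.prems[THEN C_diff_Suc_has_derivative]]])
      (use Suc in auto)
qed

lemma C_diff_inner:
  "C_diff k h \<Longrightarrow> C_diff k g \<Longrightarrow> C_diff k (\<lambda>x. h x \<bullet> g x)"
proof (induction k arbitrary: h g)
  case 0
  then show ?case by (auto intro: continuous_on_inner)
next
  case (Suc k)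
  have "C_diff k h" "C_diff k g" using Suc.prems C_diff_Suc_D by blast+
  with Suc show ?case
    by (intro C_diff_SucI[OF has_derivative_inner[OF Suc.prems[THEN C_diff_Suc_has_derivative]]]
        C_diff_add) auto
qed

lemma C_diff_mult:
  fixes h g :: "'a::euclidean_space \<Rightarrow> real"
  shows "C_diff k h \<Longrightarrow> C_diff k g \<Longrightarrow> C_diff k (\<lambda>x. h x * g x)"
  using C_diff_inner[of k h g] by simp

lemma C_diff_sum:
  "(\<And>i. i \<in> I \<Longrightarrow> C_diff k (h i)) \<Longrightarrow> C_diff k (\<lambda>x. \<Sum>i\<in>I. h i x)"
  by (induction I rule: infinite_finite_induct) (auto intro: C_diff_const C_diff_add)

lemma linear_functional_expansion:
  fixes f :: "'a::euclidean_space \<Rightarrow> real"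
  assumes "linear f"
  shows "f v = (\<Sum>b\<in>Basis. (v \<bullet> b) * f b)"
proof -
  have "f v = f (\<Sum>b\<in>Basis. (v \<bullet> b) *\<^sub>R b)" by (simp only: euclidean_representation)
  then show ?thesis using assms by (simp add: linear_sum linear_scale)
qed

text \<open>Differentiating along a linear vector field \<open>f\<close> costs one order of smoothness, since
  the derivative is the combination of the partial derivatives with the coordinates of
  \<open>f z\<close> as coefficients.  Applied on the product space to the field \<open>(x, u) \<mapsto> (u, 0)\<close>, this
  gives the joint smoothness of \<open>D\<^sub>u h x\<close> in the point \<open>x\<close> and the direction \<open>u\<close>.\<close>

lemma C_diff_derivative_along_linear_field:
  fixes h :: "'a::euclidean_space \<Rightarrow> real"
  assumes h: "C_diff (Suc k) h" and f: "linear f"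
  shows "C_diff k (\<lambda>z. frechet_derivative h (at z) (f z))"
proof -
  have lin: "linear (frechet_derivative h (at z))" for z
    using C_diff_Suc_has_derivative[OF h] has_derivative_linear by blast
  have "frechet_derivative h (at z) (f z) =
      (\<Sum>b\<in>Basis. (f z \<bullet> b) * frechet_derivative h (at z) b)" for z
    using linear_functional_expansion[OF lin] .
  moreover have "C_diff k (\<lambda>z. \<Sum>b\<in>Basis. (f z \<bullet> b) * frechet_derivative h (at z) b)"
    using h by (intro C_diff_sum C_diff_mult C_diff_inner C_diff_linear[OF f] C_diff_const) auto
  ultimately show ?thesis by simp
qed

text \<open>The iterated derivatives \<open>D\<^sub>u\<^sup>m h x\<close> as functions of the pair \<open>(x, u)\<close>.\<close>

primrec ray_deriv ::
    "nat \<Rightarrow> ('a::euclidean_space \<Rightarrow> real) \<Rightarrow> 'a \<times> 'a \<Rightarrow> real" where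
  "ray_deriv 0 h = (\<lambda>z. h (fst z))"
| "ray_deriv (Suc m) h = (\<lambda>z. frechet_derivative (ray_deriv m h) (at z) (snd z, 0))"

lemma C_diff_ray_deriv: "C_diff (k + m) h \<Longrightarrow> C_diff k (ray_deriv m h)"
proof (induction m arbitrary: k)
  case 0
  then show ?case by (simp add: C_diff_comp_linear[OF linear_fst])
next
  case (Suc m)
  have "linear (\<lambda>z :: 'a \<times> 'a. (snd z, 0 :: 'a))"
    by (rule linearI) simp_all
  moreover have "C_diff (Suc k) (ray_deriv m h)"
    using Suc.IH[of "Suc k"] Suc.prems by simp
  ultimately show ?case
    using C_diff_derivative_along_linear_field by (simp del: C_diff.simps(2))
qed

lemma continuous_ray_deriv:
  assumes "smooth h"
  shows "continuous_on UNIV (ray_deriv m h)"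
  using C_diff_ray_deriv[of 0 m h] assms by (simp add: smooth_def)

lemma ray_deriv_has_derivative:
  assumes "smooth h"
  shows "((\<lambda>t. ray_deriv m h (x + t *\<^sub>R u, u)) has_real_derivative
           ray_deriv (Suc m) h (x + t *\<^sub>R u, u)) (at t)"
proof -
  let ?z = "(x + t *\<^sub>R u, u)"
  have "C_diff (Suc 0) (ray_deriv m h)"
    using C_diff_ray_deriv[of "Suc 0" m h] assms unfolding smooth_def by blast
  note D = C_diff_Suc_has_derivative[OF this, of ?z]
  have "((\<lambda>t. (x + t *\<^sub>R u, u)) has_derivative (\<lambda>s. (s *\<^sub>R u, 0))) (at t)"
    by (auto intro!: derivative_eq_intros)
  from has_derivative_compose[OF this D]
  have "((\<lambda>t. ray_deriv m h (x + t *\<^sub>R u, u)) has_derivative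
      (\<lambda>s. frechet_derivative (ray_deriv m h) (at ?z) (s *\<^sub>R u, 0))) (at t)" .
  moreover have "frechet_derivative (ray_deriv m h) (at ?z) (s *\<^sub>R u, 0) =
      ray_deriv (Suc m) h ?z * s" for s
    using linear_scale[OF has_derivative_linear[OF D], of s "(u, 0)"] by simp
  ultimately show ?thesis by (simp add: has_field_derivative_def)
qed

lemma dir_deriv_eq_ray_deriv:
  assumes "smooth h"
  shows "dir_deriv m h x u = ray_deriv m h (x, u)"
proof -
  have "iter_deriv m (\<lambda>t. h (x + t *\<^sub>R u)) = (\<lambda>t. ray_deriv m h (x + t *\<^sub>R u, u))"
  proof (induction m)
    case 0
    then show ?case by (simp add: iter_deriv_def)
  next
    case (Suc m)
    show ?case
    proof
      fix t
      have "iter_deriv (Suc m) (\<lambda>t. h (x + t *\<^sub>R u)) t =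
          vector_derivative (\<lambda>t. ray_deriv m h (x + t *\<^sub>R u, u)) (at t)"
        using Suc by (simp add: iter_deriv_def)
      also have "\<dots> = ray_deriv (Suc m) h (x + t *\<^sub>R u, u)"
        using ray_deriv_has_derivative[OF assms]
        by (intro vector_derivative_at)
          (simp add: has_real_derivative_iff_has_vector_derivative del: ray_deriv.simps)
      finally show "iter_deriv (Suc m) (\<lambda>t. h (x + t *\<^sub>R u)) t =
          ray_deriv (Suc m) h (x + t *\<^sub>R u, u)" .
    qed
  qed
  then show ?thesis by (simp add: dir_deriv_def)
qed

text \<open>Third derivatives do not see quadratic terms.  The identity is differentiated three
  times along the line, so only the restrictions to that line matter.\<close>

lemma ray_deriv_3_of_quadratic_remainder:
  fixes h k :: "'a::euclidean_space \<Rightarrow> real"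
  assumes h: "smooth h" and k: "smooth k"
    and quad: "\<And>t. h (x + t *\<^sub>R u) = a + b * t + c * t\<^sup>2 - k (x + t *\<^sub>R u)"
  shows "ray_deriv 3 h (x, u) = - ray_deriv 3 k (x, u)"
proof -
  have step: "p' = q'" if "(p has_real_derivative p') (at t)" "(q has_real_derivative q') (at t)"
    "p = q" for p q p' q' t using that DERIV_unique by blast
  let ?h = "\<lambda>m t. ray_deriv m h (x + t *\<^sub>R u, u)" and ?k = "\<lambda>m t. ray_deriv m k (x + t *\<^sub>R u, u)"
  note Dk = ray_deriv_has_derivative[OF k] and Dh = ray_deriv_has_derivative[OF h]
  have 0: "?h 0 = (\<lambda>t. a + b * t + c * t\<^sup>2 - ?k 0 t)" using quad by auto
  have 1: "?h (Suc 0) = (\<lambda>t. b + 2 * c * t - ?k (Suc 0) t)"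
    by (rule ext, rule step[OF Dh _ 0])
      (auto intro!: derivative_eq_intros Dk[of 0, unfolded ray_deriv.simps] Dk simp del: ray_deriv.simps)
  have 2: "?h (Suc (Suc 0)) = (\<lambda>t. 2 * c - ?k (Suc (Suc 0)) t)"
    by (rule ext, rule step[OF Dh _ 1])
      (auto intro!: derivative_eq_intros Dk simp del: ray_deriv.simps)
  have 3: "?h (Suc (Suc (Suc 0))) = (\<lambda>t. - ?k (Suc (Suc (Suc 0))) t)"
    by (rule ext, rule step[OF Dh _ 2])
      (auto intro!: derivative_eq_intros Dk simp del: ray_deriv.simps)
  show ?thesis using fun_cong[OF 3, of 0] by (simp add: numeral_3_eq_3 del: ray_deriv.simps)
qed


section \<open>The information operator\<close>

lemma gradient_eq_sum_partial_derivatives: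
  fixes h :: "'a::euclidean_space \<Rightarrow> real"
  assumes "smooth h"
  shows "GDERIV h x :> gradient h x"
    and "gradient h x = (\<Sum>b\<in>Basis. frechet_derivative h (at x) b *\<^sub>R b)"
proof -
  let ?g = "\<Sum>b\<in>Basis. frechet_derivative h (at x) b *\<^sub>R b"
  have "C_diff (Suc 0) h" using assms by (simp add: smooth_def del: C_diff.simps)
  note D = C_diff_Suc_has_derivative[OF this, of x]
  have "frechet_derivative h (at x) = (\<lambda>v. v \<bullet> ?g)"
  proof
    fix v
    have "v \<bullet> ?g = (\<Sum>b\<in>Basis. (v \<bullet> b) * frechet_derivative h (at x) b)"
      by (simp add: inner_sum_right mult.commute)
    then show "frechet_derivative h (at x) v = v \<bullet> ?g"
      by (simp only: linear_functional_expansion[OF has_derivative_linear[OF D], symmetric])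
  qed
  with D have g: "GDERIV h x :> ?g" by (simp add: gderiv_def)
  have unique: "e = ?g" if "GDERIV h x :> e" for e
  proof -
    have "(\<lambda>v. v \<bullet> e) = (\<lambda>v. v \<bullet> ?g)"
      using that g unfolding gderiv_def by (rule has_derivative_unique)
    then have "\<And>v. v \<bullet> e = v \<bullet> ?g" by (rule fun_cong)
    then show ?thesis by (subst vector_eq_ldot[symmetric]) blast
  qed
  show "gradient h x = ?g" unfolding gradient_def using g unique by (rule the_equality)
  with g show "GDERIV h x :> gradient h x" by simp
qed

lemma gradient_has_derivative_hessian:
  fixes h :: "'a::euclidean_space \<Rightarrow> real"
  assumes "smooth h"
  shows "(gradient h has_derivative hessian h x) (at x)"
proof -
  have "C_diff (Suc (Suc 0)) h" using assms by (simp add: smooth_def del: C_diff.simps)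
  then have "(\<lambda>x. frechet_derivative h (at x) b) differentiable (at x)" for b by simp
  then have "(\<lambda>x. \<Sum>b\<in>Basis. frechet_derivative h (at x) b *\<^sub>R b) differentiable (at x)"
    by (intro differentiable_sum differentiable_scaleR) auto
  moreover have "gradient h = (\<lambda>x. \<Sum>b\<in>Basis. frechet_derivative h (at x) b *\<^sub>R b)"
    using gradient_eq_sum_partial_derivatives(2)[OF assms] by auto
  ultimately show ?thesis by (simp add: hessian_def frechet_derivative_works)
qed

lemma ray_deriv_1_eq_gradient:
  assumes "smooth h"
  shows "ray_deriv 1 h (x, u) = gradient h x \<bullet> u"
proof -
  have "((\<lambda>t. x + t *\<^sub>R u) has_derivative (\<lambda>s. s *\<^sub>R u)) (at 0)"
    by (auto intro!: derivative_eq_intros)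
  moreover have "(h has_derivative (\<lambda>v. v \<bullet> gradient h x)) (at (x + 0 *\<^sub>R u))"
    using gradient_eq_sum_partial_derivatives(1)[OF assms, of x] by (simp add: gderiv_def)
  ultimately have "((\<lambda>t. h (x + t *\<^sub>R u)) has_derivative (\<lambda>s. (s *\<^sub>R u) \<bullet> gradient h x)) (at 0)"
    by (rule has_derivative_compose)
  then have "((\<lambda>t. h (x + t *\<^sub>R u)) has_real_derivative gradient h x \<bullet> u) (at 0)"
    by (rule has_derivative_imp_has_field_derivative) (simp add: inner_commute)
  moreover have "((\<lambda>t. h (x + t *\<^sub>R u)) has_real_derivative ray_deriv 1 h (x, u)) (at 0)"
    using ray_deriv_has_derivative[OF assms, of 0 x u 0] by simp
  ultimately show ?thesis by (rule DERIV_unique[symmetric])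
qed

lemma ray_deriv_2_eq_info_op:
  assumes "smooth h"
  shows "ray_deriv 2 h (x, u) = - (info_op h x u \<bullet> u)"
proof -
  have "((\<lambda>t. x + t *\<^sub>R u) has_derivative (\<lambda>s. s *\<^sub>R u)) (at 0)"
    by (auto intro!: derivative_eq_intros)
  moreover have "(gradient h has_derivative hessian h x) (at (x + 0 *\<^sub>R u))"
    using gradient_has_derivative_hessian[OF assms, of x] by simp
  ultimately have "((\<lambda>t. gradient h (x + t *\<^sub>R u)) has_derivative (\<lambda>s. hessian h x (s *\<^sub>R u))) (at 0)"
    by (rule has_derivative_compose)
  then have "((\<lambda>t. gradient h (x + t *\<^sub>R u) \<bullet> u) has_derivative (\<lambda>s. hessian h x (s *\<^sub>R u) \<bullet> u)) (at 0)"
    by (rule has_derivative_inner_left)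
  moreover have "hessian h x (s *\<^sub>R u) \<bullet> u = s * (hessian h x u \<bullet> u)" for s
    using gradient_has_derivative_hessian[OF assms, of x]
    by (simp add: linear_scale[OF has_derivative_linear])
  ultimately have "((\<lambda>t. gradient h (x + t *\<^sub>R u) \<bullet> u) has_real_derivative hessian h x u \<bullet> u) (at 0)"
    by (auto intro: has_derivative_imp_has_field_derivative)
  moreover have "((\<lambda>t. gradient h (x + t *\<^sub>R u) \<bullet> u) has_real_derivative ray_deriv 2 h (x, u)) (at 0)"
    using ray_deriv_has_derivative[OF assms, of 1 x u 0]
    by (simp add: ray_deriv_1_eq_gradient[OF assms, unfolded One_nat_def] numeral_2_eq_2
        del: ray_deriv.simps)
  ultimately have "hessian h x u \<bullet> u = ray_deriv 2 h (x, u)" by (rule DERIV_unique)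
  then show ?thesis by (simp add: info_op_def del: ray_deriv.simps)
qed

text \<open>By the mean value theorem the second difference of \<open>h\<close> over the parallelogram spanned by
  \<open>s u\<close> and \<open>s v\<close> is \<open>s\<close> times an increment of the gradient, hence \<open>s\<^sup>2 (H u \<bullet> v) + o(s\<^sup>2)\<close>,
  where \<open>H\<close> is the derivative of the gradient at \<open>x\<close>.\<close>

lemma second_difference_tendsto:
  fixes h :: "'a::euclidean_space \<Rightarrow> real"
  assumes G: "\<And>y. GDERIV h y :> g y" and H: "(g has_derivative H) (at x)"
  shows "((\<lambda>s. (h (x + s *\<^sub>R u + s *\<^sub>R v) - h (x + s *\<^sub>R u) - h (x + s *\<^sub>R v) + h x) / s\<^sup>2)
           \<longlongrightarrow> H u \<bullet> v) (at_right 0)"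
proof (rule tendstoI)
  fix e :: real assume "e > 0"
  have lin: "linear H" using H has_derivative_linear by blast
  define K where "K = norm u + norm v + 1"
  \<comment> \<open>Two remainders of size at most \<open>e' s K\<close>, each paired with \<open>v\<close>, must stay below \<open>s e\<close>.\<close>
  define e' where "e' = e / (2 * K * K)"
  have "K > 0" by (simp add: K_def add_nonneg_pos)
  then have "e' > 0" using \<open>e > 0\<close> by (simp add: e'_def)
  then obtain d where "d > 0"
    and d: "\<And>y. norm (y - x) < d \<Longrightarrow> norm (g y - g x - H (y - x)) \<le> e' * norm (y - x)"
    using H unfolding has_derivative_at_alt by blast
  have "dist ((h (x + s *\<^sub>R u + s *\<^sub>R v) - h (x + s *\<^sub>R u) - h (x + s *\<^sub>R v) + h x) / s\<^sup>2) (H u \<bullet> v) < e"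
    if s: "0 < s" "s < d / K" for s
  proof -
    let ?p = "\<lambda>t. h (x + s *\<^sub>R u + t *\<^sub>R v) - h (x + t *\<^sub>R v)"
    have ray: "((\<lambda>t. h (y + t *\<^sub>R v)) has_real_derivative g (y + t *\<^sub>R v) \<bullet> v) (at t)" for y t
    proof -
      have "((\<lambda>t. y + t *\<^sub>R v) has_derivative (\<lambda>s. s *\<^sub>R v)) (at t)"
        by (auto intro!: derivative_eq_intros)
      from has_derivative_compose[OF this G[unfolded gderiv_def]] show ?thesis
        by (rule has_derivative_imp_has_field_derivative) (simp add: inner_commute)
    qed
    have "(?p has_real_derivative (g (x + s *\<^sub>R u + t *\<^sub>R v) - g (x + t *\<^sub>R v)) \<bullet> v) (at t)" for t
      using DERIV_diff[OF ray ray] by (simp add: inner_diff_left)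
    \<comment> \<open>Mean value theorem for the difference in direction \<open>u\<close>, moved along \<open>v\<close>.\<close>
    from MVT2[OF \<open>0 < s\<close> this]
    obtain \<theta> where \<theta>: "0 < \<theta>" "\<theta> < s"
      and mvt: "?p s - ?p 0 = (s - 0) * ((g (x + s *\<^sub>R u + \<theta> *\<^sub>R v) - g (x + \<theta> *\<^sub>R v)) \<bullet> v)"
      by auto
    have sK: "s * K < d" using s \<open>K > 0\<close> by (simp add: field_simps)
    have n1: "norm (s *\<^sub>R u + \<theta> *\<^sub>R v) \<le> s * K"
    proof -
      have "norm (s *\<^sub>R u + \<theta> *\<^sub>R v) \<le> s * norm u + \<theta> * norm v"
        using norm_triangle_ineq[of "s *\<^sub>R u" "\<theta> *\<^sub>R v"] s \<theta> by simp
      also have "\<dots> \<le> s * norm u + s * norm v" using \<theta> by (simp add: mult_right_mono)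
      finally show ?thesis using s by (simp add: K_def distrib_left)
    qed
    have n2: "norm (\<theta> *\<^sub>R v) \<le> s * K"
    proof -
      have "norm (\<theta> *\<^sub>R v) \<le> s * norm v" using \<theta> by (simp add: mult_right_mono)
      also have "\<dots> \<le> s * K" using s by (simp add: K_def)
      finally show ?thesis .
    qed
    define R where "R w = g (x + w) - g x - H w" for w
    have R: "norm (R w) \<le> e' * (s * K)" if "norm w \<le> s * K" for w
      using d[of "x + w"] that sK \<open>e' > 0\<close> unfolding R_def
      by (smt (verit) add_diff_cancel_left' mult_left_mono)
    have incr: "g (x + s *\<^sub>R u + \<theta> *\<^sub>R v) - g (x + \<theta> *\<^sub>R v) = s *\<^sub>R H u + (R (s *\<^sub>R u + \<theta> *\<^sub>R v) - R (\<theta> *\<^sub>R v))"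
      using lin by (simp add: R_def linear_add linear_scale add.assoc)
    have "?p s - ?p 0 = s\<^sup>2 * (H u \<bullet> v) + s * ((R (s *\<^sub>R u + \<theta> *\<^sub>R v) - R (\<theta> *\<^sub>R v)) \<bullet> v)"
      unfolding mvt incr by (simp add: inner_add_left power2_eq_square distrib_left)
    then have quot: "(?p s - ?p 0) / s\<^sup>2 - H u \<bullet> v = ((R (s *\<^sub>R u + \<theta> *\<^sub>R v) - R (\<theta> *\<^sub>R v)) \<bullet> v) / s"
      using s by (simp add: field_simps power2_eq_square)
    have rem: "\<bar>(R (s *\<^sub>R u + \<theta> *\<^sub>R v) - R (\<theta> *\<^sub>R v)) \<bullet> v\<bar> < s * e"
    proof -
      have "\<bar>(R (s *\<^sub>R u + \<theta> *\<^sub>R v) - R (\<theta> *\<^sub>R v)) \<bullet> v\<bar> \<le>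
          norm (R (s *\<^sub>R u + \<theta> *\<^sub>R v) - R (\<theta> *\<^sub>R v)) * norm v"
        by (rule Cauchy_Schwarz_ineq2)
      also have "\<dots> \<le> (2 * (e' * (s * K))) * norm v"
        using norm_triangle_ineq4[of "R (s *\<^sub>R u + \<theta> *\<^sub>R v)" "R (\<theta> *\<^sub>R v)"] R[OF n1] R[OF n2]
        by (intro mult_right_mono) auto
      also have "\<dots> < (2 * (e' * (s * K))) * K"
        using s \<open>e' > 0\<close> \<open>K > 0\<close> norm_ge_zero[of u]
        by (intro mult_strict_left_mono) (simp_all add: K_def add_nonneg_pos)
      also have "\<dots> = s * e" using \<open>K > 0\<close> by (simp add: e'_def)
      finally show ?thesis .
    qed
    have "\<bar>(?p s - ?p 0) / s\<^sup>2 - H u \<bullet> v\<bar> < e"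
      unfolding quot abs_divide using s rem by (simp add: pos_divide_less_eq mult.commute)
    moreover have "?p s - ?p 0 = h (x + s *\<^sub>R u + s *\<^sub>R v) - h (x + s *\<^sub>R u) - h (x + s *\<^sub>R v) + h x"
      by simp
    ultimately show ?thesis by (simp only: dist_real_def)
  qed
  then show "\<forall>\<^sub>F s in at_right 0. dist ((h (x + s *\<^sub>R u + s *\<^sub>R v) - h (x + s *\<^sub>R u) -
      h (x + s *\<^sub>R v) + h x) / s\<^sup>2) (H u \<bullet> v) < e"
    using \<open>d > 0\<close> \<open>K > 0\<close> unfolding eventually_at_right_field
    by (intro exI[of _ "d / K"]) auto
qed

text \<open>The second difference does not change when \<open>u\<close> and \<open>v\<close> are exchanged.\<close>

lemma sym_op_info_op:
  assumes "smooth h"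
  shows "sym_op (info_op h x)"
proof -
  note G = gradient_eq_sum_partial_derivatives(1)[OF assms]
  note H = gradient_has_derivative_hessian[OF assms, of x]
  have "hessian h x u \<bullet> v = hessian h x v \<bullet> u" for u v
  proof (rule tendsto_unique[OF trivial_limit_at_right_real second_difference_tendsto[OF G H]])
    show "((\<lambda>s. (h (x + s *\<^sub>R u + s *\<^sub>R v) - h (x + s *\<^sub>R u) - h (x + s *\<^sub>R v) + h x) / s\<^sup>2)
        \<longlongrightarrow> hessian h x v \<bullet> u) (at_right 0)"
      using second_difference_tendsto[OF G H, of v u]
      by (rule back_subst[where P = "\<lambda>f. (f \<longlongrightarrow> _) _"]) (auto simp: algebra_simps)
  qed
  moreover have "linear (info_op h x)"
    using has_derivative_linear[OF H] unfolding info_op_def[abs_def]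
    by (rule linear_compose_neg)
  ultimately show ?thesis
    unfolding sym_op_def by (simp add: info_op_def inner_commute)
qed
section \<open>Localization of a perturbed maximizer\<close>

lemma concave_on_along_ray:
  fixes h :: "'a::real_vector \<Rightarrow> real"
  assumes "concave_on U h" and "x \<in> U" "x + T *\<^sub>R u \<in> U" and "T > 0"
  shows "concave_on {0..T} (\<lambda>t. h (x + t *\<^sub>R u))"
proof -
  have cvx: "convex U" using assms(1) by (simp add: concave_on_def convex_on_def)
  have mem: "x + t *\<^sub>R u \<in> U" if "t \<in> {0..T}" for t
  proof -
    have "(1 - t / T) *\<^sub>R x + (t / T) *\<^sub>R (x + T *\<^sub>R u) \<in> U"
      using that assms by (intro convexD[OF cvx]) (auto simp: field_simps)
    moreover have "(1 - t / T) *\<^sub>R x + (t / T) *\<^sub>R (x + T *\<^sub>R u) = x + t *\<^sub>R u"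
      using \<open>T > 0\<close> by (simp add: algebra_simps)
    ultimately show ?thesis by simp
  qed
  show ?thesis
    unfolding concave_on_iff
  proof (intro conjI ballI allI impI)
    fix s t a b :: real
    assume st: "s \<in> {0..T}" "t \<in> {0..T}" and ab: "0 \<le> a" "0 \<le> b" "a + b = 1"
    have "a *\<^sub>R (x + s *\<^sub>R u) + b *\<^sub>R (x + t *\<^sub>R u) = (a + b) *\<^sub>R x + (a * s + b * t) *\<^sub>R u"
      by (simp add: algebra_simps)
    then have "a *\<^sub>R (x + s *\<^sub>R u) + b *\<^sub>R (x + t *\<^sub>R u) = x + (a *\<^sub>R s + b *\<^sub>R t) *\<^sub>R u"
      using ab by simp
    then show "a * h (x + s *\<^sub>R u) + b * h (x + t *\<^sub>R u) \<le> h (x + (a *\<^sub>R s + b *\<^sub>R t) *\<^sub>R u)"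
      using assms(1) mem[OF st(1)] mem[OF st(2)] ab unfolding concave_on_iff by metis
  qed simp
qed

text \<open>A concave function does not decrease before its maximizer \<open>T\<close>.  At \<open>1 < T\<close> it therefore
  cannot have a nonpositive slope that is about to decrease; the strict second-order
  condition makes the argument work also if the slope at \<open>1\<close> is zero.\<close>

lemma concave_max_beyond_descent_False:
  fixes h h' :: "real \<Rightarrow> real"
  assumes conc: "concave_on {0..T} h" and "T > 1" and max: "\<And>s. s \<in> {0..T} \<Longrightarrow> h s \<le> h T"
    and D: "\<And>s. (h has_real_derivative h' s) (at s)"
    and D2: "(h' has_real_derivative c) (at 1)" and "h' 1 \<le> 0" "c < 0"
  shows False
proof -
  obtain d where "d > 0" and d: "\<And>e. 0 < e \<Longrightarrow> e < d \<Longrightarrow> h' (1 + e) < h' 1"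
    using DERIV_neg_dec_right[OF D2 \<open>c < 0\<close>] by blast
  define s where "s = 1 + min (d / 2) ((T - 1) / 2)"
  have s: "1 < s" "s < T" using \<open>d > 0\<close> \<open>T > 1\<close> by (auto simp: s_def min_def field_simps)
  have "h' s < 0"
    using d[of "s - 1"] \<open>d > 0\<close> \<open>T > 1\<close> \<open>h' 1 \<le> 0\<close> s by (auto simp: s_def min_def split: if_splits)
  from DERIV_neg_dec_right[OF D this]
  obtain d' where "d' > 0" and d': "\<And>e. 0 < e \<Longrightarrow> e < d' \<Longrightarrow> h (s + e) < h s" by blast
  define e where "e = min (d' / 2) ((T - s) / 2)"
  have e: "0 < e" "e < d'" "e < T - s" using \<open>d' > 0\<close> s by (auto simp: e_def min_def field_simps)
  define t where "t = e / (T - s)"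
  have t: "0 \<le> t" "t \<le> 1" using e by (auto simp: t_def field_simps)
  have "(1 - t) * h s + t * h T \<le> h ((1 - t) *\<^sub>R s + t *\<^sub>R T)"
    using concave_onD[OF conc t, of s T] s by simp
  also have "(1 - t) *\<^sub>R s + t *\<^sub>R T = s + e"
  proof -
    have "t * (T - s) = e" using s by (simp add: t_def)
    then show ?thesis by (simp add: algebra_simps)
  qed
  finally have "(1 - t) * h s + t * h T < h s" using d'[OF e(1,2)] by simp
  moreover have "t * h s \<le> t * h T" using max[of s] s t by (simp add: mult_left_mono)
  ultimately show False by (simp add: algebra_simps)
qed

lemma interior_max_ray_derivatives:
  fixes f :: "'a::euclidean_space \<Rightarrow> real"
  assumes f: "smooth f" and "open U" and max: "is_arg_max f (\<lambda>x. x \<in> U) x"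
  shows "ray_deriv 1 f (x, u) = 0" and "ray_deriv 2 f (x, u) \<le> 0"
proof -
  let ?p = "\<lambda>m t. ray_deriv m f (x + t *\<^sub>R u, u)"
  have D0: "((\<lambda>t. f (x + t *\<^sub>R u)) has_real_derivative ?p 1 t) (at t)" for t
    using ray_deriv_has_derivative[OF f, of 0 x u t] by simp
  have D1: "(?p 1 has_real_derivative ?p 2 t) (at t)" for t
    using ray_deriv_has_derivative[OF f, of 1 x u t] by (simp add: numeral_2_eq_2 del: ray_deriv.simps)
  have "x \<in> U" and le: "\<And>y. y \<in> U \<Longrightarrow> f y \<le> f x"
    using max by (auto simp: is_arg_max_def not_less)
  have "open ((\<lambda>t. x + t *\<^sub>R u) -` U)"
    by (intro open_vimage \<open>open U\<close> continuous_intros)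
  moreover have "0 \<in> (\<lambda>t. x + t *\<^sub>R u) -` U" using \<open>x \<in> U\<close> by simp
  ultimately obtain d where "d > 0" and sub: "ball 0 d \<subseteq> (\<lambda>t. x + t *\<^sub>R u) -` U"
    using openE by meson
  have d: "f (x + t *\<^sub>R u) \<le> f x" if "\<bar>t\<bar> < d" for t
    using subsetD[OF sub, of t] that by (intro le) simp
  have "?p 1 0 = 0"
    by (rule DERIV_local_max[OF D0 \<open>d > 0\<close>]) (use d in auto)
  then show p0: "ray_deriv 1 f (x, u) = 0" by simp
  show "ray_deriv 2 f (x, u) \<le> 0"
  proof (rule ccontr)
    assume "\<not> ?thesis"
    then have "0 < ?p 2 0" by simp
    from DERIV_pos_inc_right[OF D1 this] obtain e where "e > 0"
      and e: "\<And>t. 0 < t \<Longrightarrow> t < e \<Longrightarrow> ?p 1 0 < ?p 1 t" by auto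
    define t where "t = min d e / 2"
    have t: "0 < t" "t < d" "t < e" using \<open>d > 0\<close> \<open>e > 0\<close> by (auto simp: t_def min_def)
    obtain s where s: "0 < s" "s < t" and "f (x + t *\<^sub>R u) - f (x + 0 *\<^sub>R u) = (t - 0) * ?p 1 s"
      using MVT2[OF t(1) D0] by auto
    moreover have "0 < ?p 1 s" using e[of s] s t p0 by simp
    ultimately have "f x < f (x + t *\<^sub>R u)" using t
      by (metis add.right_neutral diff_gt_0_iff_gt diff_zero mult_pos_pos scaleR_zero_left)
    with d[of t] t show False by simp
  qed
qed

lemma psd_op_info_op_at_max:
  assumes "smooth f" and "open U" and "is_arg_max f (\<lambda>x. x \<in> U) x"
  shows "psd_op (info_op f x)"
  using sym_op_info_op[OF assms(1)] interior_max_ray_derivatives(2)[OF assms]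
  by (simp add: psd_op_def ray_deriv_2_eq_info_op[OF assms(1)])

lemma psd_op_norm_root:
  assumes "psd_op D" "D \<circ> D = F"
  shows "F u \<bullet> u = (norm (D u))\<^sup>2"
proof -
  have "F u = D (D u)" using assms(2) by auto
  then show ?thesis using assms(1) by (simp add: psd_op_def sym_op_def power2_norm_eq_inner)
qed

text \<open>If \<open>z\<close> lay outside the local set, the segment from \<open>x\<close> to \<open>z\<close> would leave it at a point
  \<open>x + u\<close> with \<open>\<parallel>D u\<parallel> = r\<close>.  Along this ray the second derivative of \<open>f\<close> starts at \<open>-r\<^sup>2\<close> and
  changes by at most \<open>\<delta>\<close> up to the boundary, so the slope of \<open>f\<close> there is at most
  \<open>-r\<^sup>2 + \<delta>\<close>.  The perturbation contributes at most \<open>(1 - \<rho>) r\<^sup>2\<close> to the slope, which leaves at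
  most \<open>\<delta> - \<rho> r\<^sup>2 \<le> 0\<close>: the perturbed function descends before it reaches \<open>z\<close>.\<close>

lemma perturbed_max_in_local_set:
  fixes f :: "'a::euclidean_space \<Rightarrow> real"
  assumes f: "smooth f" and "open U" and conc: "concave_on U f"
    and x: "is_arg_max f (\<lambda>v. v \<in> U) x"
    and z: "is_arg_max (\<lambda>v. f v + w \<bullet> v) (\<lambda>v. v \<in> U) z"
    and D: "psd_op D" "D \<circ> D = info_op f x"
    and third: "\<And>v u. norm (D (v - x)) \<le> r \<Longrightarrow> norm (D u) \<le> r \<Longrightarrow> \<bar>ray_deriv 3 f (v, u)\<bar> \<le> \<delta>"
    and noise: "\<And>u. w \<bullet> u \<le> (1 - \<rho>) * r * norm (D u)"
    and r: "r > 0" and \<delta>: "3 * \<delta> \<le> \<rho> * r\<^sup>2" "\<rho> \<le> 1 / 2"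
  shows "norm (D (z - x)) \<le> r"
proof (rule ccontr)
  assume "\<not> ?thesis"
  then have out: "r < norm (D (z - x))" by simp
  have linD: "linear D" using D(1) by (simp add: psd_op_def sym_op_def)
  define T where "T = norm (D (z - x)) / r"
  define u where "u = (1 / T) *\<^sub>R (z - x)"
  have "T > 1" using out r by (simp add: T_def)
  then have zT: "z = x + T *\<^sub>R u" by (simp add: u_def)
  have "D (z - x) \<noteq> 0" using out r by auto
  then have Du: "norm (D u) = r"
    using out r \<open>T > 1\<close> linD by (simp add: u_def linear_scale T_def)
  have "x \<in> U" "z \<in> U" using x z by (auto simp: is_arg_max_def)
  \<comment> \<open>The absolute value at \<open>(x, u)\<close> is among those bounded by \<open>\<delta>\<close>.\<close>
  have \<delta>0: "0 \<le> \<delta>" using third[of x u] Du r linear_0[OF linD] by fastforce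
  let ?p = "\<lambda>m t. ray_deriv m f (x + t *\<^sub>R u, u)"
  have Dp: "(?p m has_real_derivative ?p (Suc m) t) (at t)" for m t
    by (rule ray_deriv_has_derivative[OF f])
  have p1: "?p 1 0 = 0" using interior_max_ray_derivatives(1)[OF f \<open>open U\<close> x] by simp
  have p2: "?p 2 0 = - r\<^sup>2"
    using psd_op_norm_root[OF D, of u] Du by (simp add: ray_deriv_2_eq_info_op[OF f])
  have p3: "\<bar>?p 3 t\<bar> \<le> \<delta>" if "0 \<le> t" "t \<le> 1" for t
    using third[of "x + t *\<^sub>R u" u] that Du r linD
    by (simp add: linear_scale mult_left_le_one_le del: ray_deriv.simps)
  have p2_le: "?p 2 t \<le> - r\<^sup>2 + \<delta>" if "0 < t" "t \<le> 1" for t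
  proof -
    from MVT2[OF \<open>0 < t\<close> Dp[of 2]]
    obtain s where s: "0 < s" "s < t" "?p 2 t - ?p 2 0 = (t - 0) * ?p (Suc 2) s" by auto
    have "t * ?p 3 s \<le> t * \<delta>" using p3[of s] s that by (intro mult_left_mono) auto
    also have "\<dots> \<le> \<delta>" using that \<delta>0 by (simp add: mult_left_le_one_le)
    finally have "t * ?p 3 s \<le> \<delta>" .
    then show ?thesis using s p2 by (simp add: numeral_3_eq_3 numeral_2_eq_2 del: ray_deriv.simps)
  qed
  have p1_le: "?p 1 1 \<le> - r\<^sup>2 + \<delta>"
  proof -
    from MVT2[OF zero_less_one Dp[of 1]]
    obtain s where "0 < s" "s < 1" "?p 1 1 - ?p 1 0 = (1 - 0) * ?p (Suc 1) s" by auto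
    then show ?thesis
      using p2_le[of s] p1 by (simp add: numeral_2_eq_2 del: ray_deriv.simps)
  qed
  let ?h = "\<lambda>t. f (x + t *\<^sub>R u) + w \<bullet> (x + t *\<^sub>R u)"
  show False
  proof (rule concave_max_beyond_descent_False[of T ?h "\<lambda>t. ?p 1 t + w \<bullet> u" "?p 2 1"])
    have "concave_on U (\<lambda>v. w \<bullet> v)"
      using conc by (auto simp: concave_on_iff inner_add_right)
    then have "concave_on U (\<lambda>v. f v + w \<bullet> v)"
      by (rule concave_on_add[OF conc])
    then show "concave_on {0..T} ?h"
      using \<open>x \<in> U\<close> \<open>z \<in> U\<close> zT \<open>T > 1\<close> by (intro concave_on_along_ray) auto
    show "?h s \<le> ?h T" if "s \<in> {0..T}" for s
    proof -
      have "convex U" using conc by (simp add: concave_on_def convex_on_def)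
      then have "(1 - s / T) *\<^sub>R x + (s / T) *\<^sub>R z \<in> U"
        using that \<open>T > 1\<close> \<open>x \<in> U\<close> \<open>z \<in> U\<close> by (intro convexD) (auto simp: field_simps)
      moreover have "(1 - s / T) *\<^sub>R x + (s / T) *\<^sub>R z = x + s *\<^sub>R u"
        using \<open>T > 1\<close> unfolding zT by (simp add: algebra_simps)
      ultimately show ?thesis using z by (auto simp: is_arg_max_def not_less zT)
    qed
    show "(?h has_real_derivative ?p 1 s + w \<bullet> u) (at s)" for s
    proof (rule DERIV_add)
      show "((\<lambda>t. f (x + t *\<^sub>R u)) has_real_derivative ?p 1 s) (at s)"
        using Dp[of 0 s] by simp
      show "((\<lambda>t. w \<bullet> (x + t *\<^sub>R u)) has_real_derivative w \<bullet> u) (at s)"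
        unfolding inner_add_right inner_scaleR_right by (auto intro!: derivative_eq_intros)
    qed
    show "((\<lambda>t. ?p 1 t + w \<bullet> u) has_real_derivative ?p 2 1) (at 1)"
      using DERIV_add[OF Dp[of 1 1] DERIV_const] by (simp add: numeral_2_eq_2 del: ray_deriv.simps)
    have "w \<bullet> u \<le> (1 - \<rho>) * r\<^sup>2" using noise[of u] Du by (simp add: power2_eq_square)
    with p1_le \<delta> \<delta>0 show "?p 1 1 + w \<bullet> u \<le> 0" by (simp add: algebra_simps)
    have "\<rho> * r\<^sup>2 \<le> 1 / 2 * r\<^sup>2" using \<delta> by (intro mult_right_mono) auto
    moreover have "0 < r\<^sup>2" using r by simp
    ultimately show "?p 2 1 < 0" using p2_le[of 1] \<delta> by linarith
  qed (use \<open>T > 1\<close> in auto)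
qed

section \<open>Bounds for the third derivative and for the noise\<close>

lemma compact_linear_preimage_cball:
  fixes D :: "'a::euclidean_space \<Rightarrow> 'b::euclidean_space"
  assumes "linear D" "inj D"
  shows "compact {v. norm (D (v - x)) \<le> r}"
proof -
  obtain B where B: "B > 0" "\<And>v. B * norm v \<le> norm (D v)"
    using linear_inj_bounded_below_pos[OF assms] by blast
  have "{v. norm (D (v - x)) \<le> r} \<subseteq> cball x (r / B)"
  proof
    fix v assume "v \<in> {v. norm (D (v - x)) \<le> r}"
    then have "B * norm (v - x) \<le> r" using B(2)[of "v - x"] by simp
    then show "v \<in> cball x (r / B)"
      using B(1) by (simp add: dist_norm norm_minus_commute field_simps)
  qed
  then have "bounded {v. norm (D (v - x)) \<le> r}"
    using bounded_cball bounded_subset by blast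
  moreover have "continuous_on UNIV D"
    using assms(1) by (simp add: linear_conv_bounded_linear linear_continuous_on)
  then have "closed {v. norm (D (v - x)) \<le> r}"
    unfolding linear_diff[OF assms(1)] by (intro closed_Collect_le continuous_intros)
  ultimately show ?thesis by (simp add: compact_eq_bounded_closed)
qed

text \<open>A supremum of reals bounds its members only if the set is bounded above.  This holds
  here because \<^term>\<open>ray_deriv 3\<close> is jointly continuous in the point and the direction, and
  both range over compact sets.\<close>

lemma delta3_upper:
  fixes A :: "'x::euclidean_space \<Rightarrow> 'y::euclidean_space"
  assumes \<Phi>: "smooth (fidelity lam A)" and D: "linear D" "inj D"
    and v: "norm (D (v - x)) \<le> r" and u: "norm (D u) \<le> r"
  shows "\<bar>ray_deriv 3 (fidelity lam A) (v, u)\<bar> \<le> delta3 lam A D x r"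
proof -
  let ?L = "{v. norm (D (v - x)) \<le> r}" and ?U = "{u. norm (D u) \<le> r}"
  let ?R = "\<lambda>v u. \<bar>ray_deriv 3 (fidelity lam A) (v, u)\<bar>"
  have "compact (?L \<times> ?U)"
    using compact_linear_preimage_cball[OF D, of x r] compact_linear_preimage_cball[OF D, of 0 r]
    by (intro compact_Times) auto
  then have "bounded (ray_deriv 3 (fidelity lam A) ` (?L \<times> ?U))"
    using continuous_on_subset[OF continuous_ray_deriv[OF \<Phi>, of 3]]
    by (intro compact_imp_bounded compact_continuous_image) auto
  then obtain K where "\<forall>c \<in> ray_deriv 3 (fidelity lam A) ` (?L \<times> ?U). \<bar>c\<bar> \<le> K"
    unfolding bounded_real by blast
  then have K: "?R v u \<le> K" if "v \<in> ?L" "u \<in> ?U" for v u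
    using that by blast
  have ne: "?U \<noteq> {}" using u by blast
  have inner: "?R v u \<le> (SUP u\<in>?U. ?R v u)" if "v \<in> ?L" "u \<in> ?U" for v u
    using that K by (intro cSUP_upper bdd_aboveI2[where M = K]) auto
  have "(SUP u\<in>?U. ?R v u) \<le> K" if "v \<in> ?L" for v
    using K[OF that] by (intro cSUP_least[OF ne]) auto
  then have outer: "(SUP u\<in>?U. ?R v u) \<le> (SUP v\<in>?L. SUP u\<in>?U. ?R v u)" if "v \<in> ?L" for v
    using that by (intro cSUP_upper bdd_aboveI2[where M = K]) auto
  have "delta3 lam A D x r = (SUP v\<in>?L. SUP u\<in>?U. ?R v u)"
    by (simp add: delta3_def loc_set_def dir_deriv_eq_ray_deriv[OF \<Phi>])
  moreover have "?R v u \<le> (SUP v\<in>?L. SUP u\<in>?U. ?R v u)"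
    by (rule order_trans[OF inner outer]) (use u v in simp_all)
  ultimately show ?thesis by (simp only:)
qed

text \<open>With \<open>w = F\<^sup>-\<^sup>1 (0, e)\<close> the pairing \<open>(0, e) \<bullet> u = F w \<bullet> u\<close> is \<open>D w \<bullet> D u\<close>, and
  \<open>\<parallel>D w\<parallel>\<^sup>2 = w \<bullet> F w\<close> is the quadratic form of the \<open>gg\<close>-block of \<open>F\<^sup>-\<^sup>1\<close> at \<open>e\<close>.\<close>

lemma inner_snd_le_gg_block:
  fixes D :: "'x::euclidean_space \<times> 'y::euclidean_space \<Rightarrow> 'x \<times> 'y"
  assumes D: "psd_op D" "D \<circ> D = F" and bij: "bij F"
  shows "e \<bullet> snd u \<le> sqrt (e \<bullet> gg_block (inv F) e) * norm (D u)"
proof -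
  define w where "w = inv F (0, e)"
  have Fw: "F w = (0, e)" unfolding w_def using bij by (simp add: bij_is_surj surj_f_inv_f)
  have "e \<bullet> gg_block (inv F) e = F w \<bullet> w"
    unfolding Fw by (simp add: gg_block_def w_def inner_prod_def)
  also have "\<dots> = (norm (D w))\<^sup>2" by (rule psd_op_norm_root[OF D])
  finally have root: "sqrt (e \<bullet> gg_block (inv F) e) = norm (D w)" by simp
  have "e \<bullet> snd u = F w \<bullet> u" unfolding Fw by (simp add: inner_prod_def)
  also have "\<dots> = D w \<bullet> D u"
  proof -
    have "F w = D (D w)" using D(2) by auto
    moreover have "\<And>a b. D a \<bullet> b = a \<bullet> D b" using D(1) unfolding psd_op_def sym_op_def by blast
    ultimately show ?thesis by metis
  qed
  also have "\<dots> \<le> norm (D w) * norm (D u)" by (rule norm_cauchy_schwarz)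
  finally show ?thesis unfolding root .
qed


section \<open>The penalized log-likelihood\<close>

lemma smooth_norm_sq:
  assumes "smooth h"
  shows "smooth (\<lambda>v. c * (norm (h v))\<^sup>2)"
  using assms unfolding smooth_def power2_norm_eq_inner
  by (auto intro!: C_diff_mult C_diff_inner C_diff_const)

lemma smooth_const: "smooth (\<lambda>v. c)"
  by (simp add: smooth_def C_diff_const)

lemma smooth_linear: "linear f \<Longrightarrow> smooth f"
  by (simp add: smooth_def C_diff_linear)

lemma smooth_diff: "smooth h \<Longrightarrow> smooth g \<Longrightarrow> smooth (\<lambda>v. h v - g v)"
  using C_diff_linear_comp[of uminus _ g] C_diff_add[of _ h "\<lambda>v. - g v"]
  by (simp add: smooth_def linear_uminus)

lemma smooth_linear_comp: "linear f \<Longrightarrow> smooth h \<Longrightarrow> smooth (\<lambda>v. f (h v))"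
  by (simp add: smooth_def C_diff_linear_comp)

lemma smooth_comp_linear: "linear f \<Longrightarrow> smooth h \<Longrightarrow> smooth (\<lambda>v. h (f v))"
  by (simp add: smooth_def C_diff_comp_linear)

lemma smooth_fidelity:
  assumes "smooth A"
  shows "smooth (fidelity lam A)"
  unfolding fidelity_def[abs_def]
  by (intro smooth_norm_sq smooth_diff smooth_linear linear_snd smooth_comp_linear[OF linear_fst assms])

lemma smooth_pen_loglik:
  assumes "smooth A" "linear G" "linear \<Gamma>"
  shows "smooth (pen_loglik \<sigma> lam A G \<Gamma> f0 g0 y)"
  unfolding pen_loglik_def[abs_def] loglik_def
  by (intro smooth_norm_sq smooth_diff smooth_const smooth_linear_comp[OF assms(2)]
      smooth_linear_comp[OF assms(3)] smooth_linear[OF linear_fst] smooth_linear[OF linear_snd]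
      smooth_fidelity[OF assms(1)])

lemma norm_sq_affine:
  fixes p q :: "'a::real_inner"
  shows "(norm (p + t *\<^sub>R q))\<^sup>2 = (norm p)\<^sup>2 + 2 * (p \<bullet> q) * t + (norm q)\<^sup>2 * t\<^sup>2"
  unfolding power2_norm_eq_inner
  by (simp add: inner_add_left inner_add_right inner_commute power2_eq_square)

text \<open>Apart from the fidelity term the penalized log-likelihood is quadratic.\<close>

lemma ray_deriv_3_pen_loglik:
  assumes A: "smooth A" and G: "linear G" and \<Gamma>: "linear \<Gamma>"
  shows "ray_deriv 3 (\<lambda>v. pen_loglik \<sigma> lam A G \<Gamma> f0 g0 y v - K) (v, u)
    = - ray_deriv 3 (fidelity lam A) (v, u)"
proof (rule ray_deriv_3_of_quadratic_remainder)
  show "smooth (\<lambda>v. pen_loglik \<sigma> lam A G \<Gamma> f0 g0 y v - K)"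
    by (intro smooth_diff smooth_const smooth_pen_loglik assms)
  show "smooth (fidelity lam A)" by (rule smooth_fidelity[OF A])
  fix t :: real
  let ?Y = "y - snd v" and ?P = "G (fst v - f0)" and ?Q = "\<Gamma> (snd v - g0)"
  have e1: "y - snd (v + t *\<^sub>R u) = ?Y + t *\<^sub>R (- snd u)" by simp
  have e2: "G (fst (v + t *\<^sub>R u) - f0) = ?P + t *\<^sub>R G (fst u)"
    using G by (simp add: linear_add linear_diff linear_scale)
  have e3: "\<Gamma> (snd (v + t *\<^sub>R u) - g0) = ?Q + t *\<^sub>R \<Gamma> (snd u)"
    using \<Gamma> by (simp add: linear_add linear_diff linear_scale)
  show "pen_loglik \<sigma> lam A G \<Gamma> f0 g0 y (v + t *\<^sub>R u) - K =
      (- (1 / (2 * \<sigma>\<^sup>2)) * (norm ?Y)\<^sup>2 - 1 / 2 * (norm ?P)\<^sup>2 - 1 / 2 * (norm ?Q)\<^sup>2 - K) +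
      (- (1 / (2 * \<sigma>\<^sup>2)) * (2 * (?Y \<bullet> (- snd u))) - ?P \<bullet> G (fst u) - ?Q \<bullet> \<Gamma> (snd u)) * t +
      (- (1 / (2 * \<sigma>\<^sup>2)) * (norm (- snd u))\<^sup>2 - 1 / 2 * (norm (G (fst u)))\<^sup>2
        - 1 / 2 * (norm (\<Gamma> (snd u)))\<^sup>2) * t\<^sup>2 - fidelity lam A (v + t *\<^sub>R u)"
    unfolding pen_loglik_def loglik_def e1 e2 e3 norm_sq_affine
    by (simp only: algebra_simps)
qed

text \<open>The quadratic terms in \<open>v\<close> do not involve the data, so replacing the data \<open>\<mu>\<close> by \<open>y\<close> only
  adds an affine function of \<open>v\<close>.  With \<open>\<mu>\<close> the mean, its slope is the noise \<open>y - \<mu>\<close> scaled by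
  \<open>\<sigma>\<^sup>-\<^sup>2\<close>, which has expectation zero.\<close>

lemma pen_loglik_shift:
  "pen_loglik \<sigma> lam A G \<Gamma> f0 g0 y v = pen_loglik \<sigma> lam A G \<Gamma> f0 g0 \<mu> v
     - (1 / (2 * \<sigma>\<^sup>2)) * (norm (y - \<mu>))\<^sup>2 - (1 / \<sigma>\<^sup>2) * ((y - \<mu>) \<bullet> (\<mu> - snd v))"
proof -
  have "(norm (y - snd v))\<^sup>2 = (norm ((\<mu> - snd v) + 1 *\<^sub>R (y - \<mu>)))\<^sup>2" by simp
  also have "\<dots> = (norm (\<mu> - snd v))\<^sup>2 + 2 * ((y - \<mu>) \<bullet> (\<mu> - snd v)) + (norm (y - \<mu>))\<^sup>2"
    unfolding norm_sq_affine by (simp add: inner_commute)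
  finally have expand: "(norm (y - snd v))\<^sup>2 =
    (norm (\<mu> - snd v))\<^sup>2 + 2 * ((y - \<mu>) \<bullet> (\<mu> - snd v)) + (norm (y - \<mu>))\<^sup>2" .
  have half: "1 / \<sigma>\<^sup>2 = 2 * (1 / (2 * \<sigma>\<^sup>2))" by simp
  show ?thesis
    unfolding pen_loglik_def loglik_def expand half by (simp only: algebra_simps)
qed

lemma expected_pen_loglik:
  fixes Y :: "'w \<Rightarrow> 'y::euclidean_space"
  assumes "prob_space M" and Y: "integrable M Y"
    and sq: "integrable M (\<lambda>\<omega>. (norm (Y \<omega> - \<mu>))\<^sup>2)" and \<mu>: "(\<integral>\<omega>. Y \<omega> \<partial>M) = \<mu>"
  shows "(\<integral>\<omega>. pen_loglik \<sigma> lam A G \<Gamma> f0 g0 (Y \<omega>) v \<partial>M) =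
    pen_loglik \<sigma> lam A G \<Gamma> f0 g0 \<mu> v - (1 / (2 * \<sigma>\<^sup>2)) * (\<integral>\<omega>. (norm (Y \<omega> - \<mu>))\<^sup>2 \<partial>M)"
proof -
  interpret prob_space M by fact
  have c: "integrable M (\<lambda>\<omega>. Y \<omega> - \<mu>)" using Y by simp
  then have i: "integrable M (\<lambda>\<omega>. (Y \<omega> - \<mu>) \<bullet> (\<mu> - snd v))" by simp
  have "(\<integral>\<omega>. (Y \<omega> - \<mu>) \<bullet> (\<mu> - snd v) \<partial>M) = (\<integral>\<omega>. Y \<omega> - \<mu> \<partial>M) \<bullet> (\<mu> - snd v)"
    using c by (intro integral_inner_left) simp
  also have "(\<integral>\<omega>. Y \<omega> - \<mu> \<partial>M) = 0" using Y \<mu> by (simp add: prob_space)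
  finally have 0: "(\<integral>\<omega>. (Y \<omega> - \<mu>) \<bullet> (\<mu> - snd v) \<partial>M) = 0" by simp
  have "(\<integral>\<omega>. pen_loglik \<sigma> lam A G \<Gamma> f0 g0 (Y \<omega>) v \<partial>M) =
    (\<integral>\<omega>. pen_loglik \<sigma> lam A G \<Gamma> f0 g0 \<mu> v - (1 / (2 * \<sigma>\<^sup>2)) * (norm (Y \<omega> - \<mu>))\<^sup>2
       - (1 / \<sigma>\<^sup>2) * ((Y \<omega> - \<mu>) \<bullet> (\<mu> - snd v)) \<partial>M)"
    by (intro Bochner_Integration.integral_cong refl pen_loglik_shift)
  also have "\<dots> = pen_loglik \<sigma> lam A G \<Gamma> f0 g0 \<mu> v
      - (1 / (2 * \<sigma>\<^sup>2)) * (\<integral>\<omega>. (norm (Y \<omega> - \<mu>))\<^sup>2 \<partial>M)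
      - (1 / \<sigma>\<^sup>2) * (\<integral>\<omega>. (Y \<omega> - \<mu>) \<bullet> (\<mu> - snd v) \<partial>M)"
    using i sq by (simp add: prob_space)
  finally show ?thesis unfolding 0 by simp
qed


section \<open>Concentration of the penalized maximum likelihood estimator\<close>

theorem theorem4p1:
  fixes M :: "'w measure"
    and Y :: "'w \<Rightarrow> 'y::euclidean_space"
    and A :: "'x::euclidean_space \<Rightarrow> 'y"
    and \<sigma> lam :: real
    and fs f0 :: 'x and g0 :: 'y
    and G :: "'x \<Rightarrow> 'x" and \<Gamma> S :: "'y \<Rightarrow> 'y"
    and \<Upsilon> \<Upsilon>\<^sub>0 \<U> :: "('x \<times> 'y) set"
    and \<upsilon>s :: "'x \<times> 'y" and \<upsilon>t :: "'w \<Rightarrow> 'x \<times> 'y"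
    and \<nu>\<^sub>0 C x r \<rho> :: real
    and \<Omega> :: "'w set"
  defines "\<epsilon> \<equiv> \<lambda>\<omega>. (1 / \<sigma>) *\<^sub>R (Y \<omega> - (\<integral>\<omega>'. Y \<omega>' \<partial>M))"
    and "LG \<equiv> \<lambda>\<omega>. pen_loglik \<sigma> lam A G \<Gamma> f0 g0 (Y \<omega>)"
    and "EL \<equiv> \<lambda>\<upsilon>. (\<integral>\<omega>. loglik \<sigma> lam A (Y \<omega>) \<upsilon> \<partial>M)"
    and "ELG \<equiv> \<lambda>\<upsilon>. (\<integral>\<omega>. pen_loglik \<sigma> lam A G \<Gamma> f0 g0 (Y \<omega>) \<upsilon> \<partial>M)"
  defines "F \<equiv> info_op EL \<upsilon>s"
    and "FG \<equiv> info_op ELG \<upsilon>s"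
  defines "DG \<equiv> op_sqrt FG"
    and "HGinv \<equiv> gg_block (inv FG)"
  defines "B \<equiv> \<lambda>g. (1 / \<sigma>\<^sup>2) *\<^sub>R S (HGinv (S g))"
  assumes model: "prob_space M" "integrable M Y" "(\<integral>\<omega>. Y \<omega> \<partial>M) = A fs"
      "smooth A" "\<sigma> > 0" "lam > 0" "psd_op G" "psd_op \<Gamma>"
    and sets: "\<Upsilon>\<^sub>0 \<subseteq> \<Upsilon>"
    and L: "cond_L \<Upsilon> ELG"
    and pop_max: "is_arg_max ELG (\<lambda>\<upsilon>. \<upsilon> \<in> \<Upsilon>) \<upsilon>s"
    and FG_invertible: "bij FG"
    and ES: "cond_ES M \<epsilon> S \<infinity> \<nu>\<^sub>0"
    and GGamma: "cond_GGamma \<sigma> A G \<Gamma> f0 g0 fs (ff_block FG) (ff_block F) C"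
    and L0: "cond_L0 A \<Upsilon>\<^sub>0 \<U>"
    and x: "x > 0"
    and \<Omega>: "\<Omega> \<in> sets M" "measure M \<Omega> \<ge> 1 - exp (- x)"
      "\<And>\<omega>. \<omega> \<in> \<Omega> \<Longrightarrow> (1 / \<sigma>\<^sup>2) * (\<epsilon> \<omega> \<bullet> HGinv (\<epsilon> \<omega>)) \<le> (z_quantile B x)\<^sup>2"
    and MLE: "\<And>\<omega>. \<omega> \<in> \<Omega> \<Longrightarrow> is_arg_max (LG \<omega>) (\<lambda>\<upsilon>. \<upsilon> \<in> \<Upsilon>) (\<upsilon>t \<omega>)"
    and radius: "r > 0" "loc_set DG \<upsilon>s r \<subseteq> \<Upsilon>\<^sub>0"
      "3 * delta3 lam A DG \<upsilon>s r / r\<^sup>2 \<le> \<rho>" "\<rho> \<le> 1 / 2"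
      "(1 - \<rho>) * r \<ge> z_quantile B x"
  shows "(\<forall>\<omega>\<in>\<Omega>. \<upsilon>t \<omega> \<in> loc_set DG \<upsilon>s r \<and> norm (DG (\<upsilon>t \<omega> - \<upsilon>s)) \<le> r) \<and>
    (r = z_quantile B x / (1 - \<rho>) \<longrightarrow>
      (\<forall>\<omega>\<in>\<Omega>. norm (DG (\<upsilon>t \<omega> - \<upsilon>s)) \<le> z_quantile B x / (1 - \<rho>)))"
proof -
  \<comment> \<open>The gap between the likelihood at the mean data and its expectation, by the variance of \<open>Y\<close>.\<close>
  define N where "N = (1 / (2 * \<sigma>\<^sup>2)) * (\<integral>\<omega>. (norm (Y \<omega> - A fs))\<^sup>2 \<partial>M)"
  have \<sigma>: "\<sigma> > 0" and A: "smooth A" and linG: "linear G" and lin\<Gamma>: "linear \<Gamma>"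
    using model by (auto simp: psd_op_def sym_op_def)
  have \<epsilon>: "\<epsilon> \<omega> = (1 / \<sigma>) *\<^sub>R (Y \<omega> - A fs)" for \<omega>
    using model(3) by (simp add: \<epsilon>_def)
  have "integrable M (\<lambda>\<omega>. \<sigma>\<^sup>2 * (norm (\<epsilon> \<omega>))\<^sup>2)"
    using ES by (simp add: cond_ES_def)
  then have sq: "integrable M (\<lambda>\<omega>. (norm (Y \<omega> - A fs))\<^sup>2)"
    using \<sigma> by (simp add: \<epsilon> power_divide)
  have ELG: "ELG = (\<lambda>v. pen_loglik \<sigma> lam A G \<Gamma> f0 g0 (A fs) v - N)"
    unfolding ELG_def N_def by (rule ext) (rule expected_pen_loglik[OF model(1,2) sq model(3)])
  have smoothELG: "smooth ELG"
    unfolding ELG by (intro smooth_diff smooth_const smooth_pen_loglik A linG lin\<Gamma>)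
  have U: "open \<Upsilon>" and conc: "concave_on \<Upsilon> ELG" using L by (auto simp: cond_L_def)
  have psdF: "psd_op FG"
    unfolding FG_def by (rule psd_op_info_op_at_max[OF smoothELG U pop_max])
  have DG: "psd_op DG" "DG \<circ> DG = FG" unfolding DG_def by (rule op_sqrt_psd[OF psdF])+
  then have linD: "linear DG" and injD: "inj DG"
    using bij_is_inj[OF FG_invertible] inj_on_imageI2[of DG DG UNIV]
    by (auto simp: psd_op_def sym_op_def)
  have "psd_op B"
    unfolding B_def HGinv_def using ES psd_op_bij_inv[OF psdF FG_invertible]
    by (intro psd_op_congruence psd_op_gg_block) (auto simp: cond_ES_def pd_op_def)
  then have z: "0 \<le> z_quantile B x" using x by (intro z_quantile_nonneg) auto
  have third: "\<bar>ray_deriv 3 ELG (v, u)\<bar> \<le> delta3 lam A DG \<upsilon>s r"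
    if "norm (DG (v - \<upsilon>s)) \<le> r" "norm (DG u) \<le> r" for v u
    unfolding ELG ray_deriv_3_pen_loglik[OF A linG lin\<Gamma>] abs_minus_cancel
    by (rule delta3_upper[OF smooth_fidelity[OF A] linD injD that])
  have main: "norm (DG (\<upsilon>t \<omega> - \<upsilon>s)) \<le> r" if \<omega>: "\<omega> \<in> \<Omega>" for \<omega>
  proof (rule perturbed_max_in_local_set[OF smoothELG U conc pop_max _ DG(1) _ third])
    \<comment> \<open>The random part of the gradient of \<open>LG \<omega>\<close>.\<close>
    let ?w = "(0, (1 / \<sigma>) *\<^sub>R \<epsilon> \<omega>) :: 'x \<times> 'y"
    show "DG \<circ> DG = info_op ELG \<upsilon>s" using DG(2) by (simp add: FG_def)
    define k where "k = N - (1 / (2 * \<sigma>\<^sup>2)) * (norm (Y \<omega> - A fs))\<^sup>2 - (1 / \<sigma>\<^sup>2) * ((Y \<omega> - A fs) \<bullet> A fs)"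
    have LG: "LG \<omega> v = (ELG v + ?w \<bullet> v) + k" for v
      unfolding LG_def ELG k_def pen_loglik_shift[of _ _ _ _ _ _ _ "Y \<omega>" _ "A fs"] \<epsilon>
      by (simp add: inner_prod_def inner_diff_right power2_eq_square right_diff_distrib)
    show "is_arg_max (\<lambda>v. ELG v + ?w \<bullet> v) (\<lambda>v. v \<in> \<Upsilon>) (\<upsilon>t \<omega>)"
      using MLE[OF \<omega>] by (simp add: is_arg_max_def LG)
    show "?w \<bullet> u \<le> (1 - \<rho>) * r * norm (DG u)" for u
    proof -
      let ?q = "\<epsilon> \<omega> \<bullet> HGinv (\<epsilon> \<omega>)"
      \<comment> \<open>Taking the root of the bound on \<open>\<Omega>\<close> requires the quantile to be nonnegative.\<close>
      have "sqrt (1 / \<sigma>\<^sup>2 * ?q) \<le> z_quantile B x"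
        using \<Omega>(3)[OF \<omega>] z by (intro real_le_lsqrt) auto
      then have q: "(1 / \<sigma>) * sqrt ?q \<le> (1 - \<rho>) * r"
        using \<sigma> radius(5) by (simp add: real_sqrt_divide)
      have "?w \<bullet> u = (1 / \<sigma>) * (\<epsilon> \<omega> \<bullet> snd u)" by (simp add: inner_prod_def)
      also have "\<dots> \<le> (1 / \<sigma>) * (sqrt ?q * norm (DG u))"
        unfolding HGinv_def using \<sigma>
        by (intro mult_left_mono inner_snd_le_gg_block[OF DG FG_invertible]) auto
      also have "\<dots> = ((1 / \<sigma>) * sqrt ?q) * norm (DG u)" by simp
      also have "\<dots> \<le> ((1 - \<rho>) * r) * norm (DG u)" by (rule mult_right_mono[OF q]) simp
      finally show ?thesis .
    qed
    show "3 * delta3 lam A DG \<upsilon>s r \<le> \<rho> * r\<^sup>2" using radius by (simp add: field_simps)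
  qed (use radius in auto)
  then show ?thesis by (auto simp: loc_set_def)
qed

end
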